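(* Let $X=\mathbb{P}^{1}$ be the Riemann sphere and $L=\mathcal{O}(1)$ its hyperplane line bundle. There exists an $S^{1}$-invariant geodesic $(\Phi_{t})_{t\in[0,1]}$ in $\mathcal{H}_{1,1}$ such that $t\mapsto\mathcal{M}(\Phi_{t})$ is affine, but $\Phi_{t}$ is not of the form $g(t)\Phi_{0}$ for a one-parameter subgroup $g(t)$ of the automorphism group $G$ of $(X,L)$.
   Context: $\mathcal{H}$ denotes the space of smooth metrics on $L$ with strictly positive curvature, and $\mathcal{H}_{1,1}$ the space of (singular) metrics $\Phi$ on $L$ with semi-positive curvature current $\omega_{\Phi}$ which is an $L^{\infty}$-form. On the affine chart $\mathbb{C}\subset\mathbb{P}^{1}$, a bounded metric is identified with a function $\Phi(z)$ with $\Phi-\log(1+|z|^{2})$ bounded, and $\omega_{\Phi}=\frac{i}{2\pi}\partial\bar\partial\Phi$; $\omega_{0}$ denotes the Fubini–Study form ($\Phi_{FS}=\log(1+|z|^{2})$). An $S^{1}$-invariant such metric corresponds to a convex function $\phi$ on $\mathbb{R}$ with $\Phi(z)=\phi(\log|z|^{2})$ and $\phi-\log(1+e^{x})$ bounded; its Legendre transform $u=\phi^{*}$, $u(y)=\sup_{x}(xy-\phi(x))$, is a bounded convex function on $[0,1]$. A curve $\Phi_{t}$ of $S^{1}$-invariant metrics is a geodesic (for the Mabuchi–Donaldson–Semmes metric) iff the corresponding Legendre transforms $u_{t}$ depend affinely on $t$. The K-energy $\mathcal{M}$ is defined on $\mathcal{H}_{1,1}$ (up to an additive constant) by the Chen–Tian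 formula $\mathcal{M}(\Phi)=\frac{\bar R}{n+1}\mathcal{E}(\Phi)-\mathcal{E}^{\mathrm{Ric}\,\omega_{0}}(\Phi)+\int_{X}\log\big(\omega_{\Phi}^{n}/\omega_{0}^{n}\big)\omega_{\Phi}^{n}$, where $n=\dim X$, $\bar R=n\,c_{1}(X)\cdot[\omega_{0}]^{n-1}/[\omega_{0}]^{n}$, and $\mathcal{E},\mathcal{E}^{\mathrm{Ric}\,\omega_{0}}$ are the functionals on $\mathcal{H}$ with differentials $d\mathcal{E}_{|\Phi}=(n+1)\omega_{\Phi}^{n}$ and $d\mathcal{E}^{\mathrm{Ric}\,\omega_{0}}_{|\Phi}=n\,\omega_{\Phi}^{n-1}\wedge\mathrm{Ric}\,\omega_{0}$, extended continuously in the $L^{\infty}$-norm. $g(t)\Phi_{0}$ denotes the pull-back of $\Phi_{0}$ under the flow of a holomorphic vector field on $X$ (a one-parameter subgroup of the automorphism group of $(X,L)$). *)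

theory Defs
  imports "HOL-Analysis.Analysis"
begin

text \<open>Everything lives on the affine chart C of P^1 (the point at infinity has
measure zero).  Metrics on L = O(1) are functions Phi : complex => real with
Phi - log(1+|z|^2) bounded.  Forms (2-forms) are identified with densities
with respect to Lebesgue measure lborel on C = R^2; for a function F one has
(i/2pi) dd-bar F = (1/(4 pi)) (Laplacian F) dx dy.\<close>

definition phiFS :: "complex \<Rightarrow> real" where
  "phiFS z = ln (1 + (cmod z)\<^sup>2)"

definition rho0 :: "complex \<Rightarrow> real" where
  "rho0 z = 1 / (pi * (1 + (cmod z)\<^sup>2)\<^sup>2)"

definition dir_deriv :: "complex \<Rightarrow> (complex \<Rightarrow> real) \<Rightarrow> complex \<Rightarrow> real" where
  "dir_deriv v f z = deriv (\<lambda>r. f (z + of_real r * v)) 0"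

definition lap :: "(complex \<Rightarrow> real) \<Rightarrow> complex \<Rightarrow> real" where
  "lap f z = dir_deriv 1 (dir_deriv 1 f) z + dir_deriv \<i> (dir_deriv \<i> f) z"

definition smooth_fun :: "(complex \<Rightarrow> real) \<Rightarrow> bool" where
  "smooth_fun f \<longleftrightarrow> (\<forall>ds. set ds \<subseteq> {1, \<i>} \<longrightarrow>
      continuous_on UNIV (foldr dir_deriv ds f) \<and>
      (\<forall>v\<in>{1, \<i>}. \<forall>z. (\<lambda>r. foldr dir_deriv ds f (z + of_real r * v)) differentiable (at 0)))"

definition test_fun :: "(complex \<Rightarrow> real) \<Rightarrow> bool" where
  "test_fun chi \<longleftrightarrow> smooth_fun chi \<and> bounded {z. chi z \<noteq> 0}"

definition weak_lap :: "(complex \<Rightarrow> real) \<Rightarrow> (complex \<Rightarrow> real) \<Rightarrow> bool" where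
  "weak_lap Phi f \<longleftrightarrow> f \<in> borel_measurable lborel \<and>
     (\<forall>chi. test_fun chi \<longrightarrow> integrable lborel (\<lambda>z. f z * chi z) \<and>
         (\<integral>z. Phi z * lap chi z \<partial>lborel) = (\<integral>z. f z * chi z \<partial>lborel))"

text \<open>density of the curvature current omega_Phi = (i/2pi) dd-bar Phi\<close>
definition curv :: "(complex \<Rightarrow> real) \<Rightarrow> complex \<Rightarrow> real" where
  "curv Phi z = (SOME f. weak_lap Phi f) z / (4 * pi)"

text \<open>H_{1,1}: bounded (continuous) metrics whose curvature current is a
semi-positive L-infinity form, i.e. 0 <= omega_Phi <= C omega_0\<close>
definition H11 :: "(complex \<Rightarrow> real) \<Rightarrow> bool" where
  "H11 Phi \<longleftrightarrow> continuous_on UNIV Phi \<and>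
     bounded (range (\<lambda>z. Phi z - phiFS z)) \<and>
     (\<exists>f. weak_lap Phi f \<and> (AE z in lborel. 0 \<le> f z) \<and>
          (\<exists>C. AE z in lborel. f z / (4 * pi) \<le> C * rho0 z))"

definition S1_invariant :: "(complex \<Rightarrow> real) \<Rightarrow> bool" where
  "S1_invariant Phi \<longleftrightarrow> (\<forall>th z. Phi (cis th * z) = Phi z)"

text \<open>the convex profile phi with Phi(z) = phi(log |z|^2)\<close>
definition profile :: "(complex \<Rightarrow> real) \<Rightarrow> real \<Rightarrow> real" where
  "profile Phi x = Phi (complex_of_real (exp (x / 2)))"

definition legendre :: "(real \<Rightarrow> real) \<Rightarrow> real \<Rightarrow> real" where
  "legendre ph y = (SUP x. x * y - ph x)"

definition S1_geodesic :: "(real \<Rightarrow> complex \<Rightarrow> real) \<Rightarrow> bool" where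
  "S1_geodesic Phi \<longleftrightarrow>
     (\<forall>t\<in>{0..1}. H11 (Phi t) \<and> S1_invariant (Phi t)) \<and>
     (\<forall>t\<in>{0..1}. \<forall>y\<in>{0..1}.
        legendre (profile (Phi t)) y
          = (1 - t) * legendre (profile (Phi 0)) y + t * legendre (profile (Phi 1)) y)"

text \<open>Ricci form of omega_0: Ric = -(i/2pi) dd-bar log(density)\<close>
definition ric0 :: "complex \<Rightarrow> real" where
  "ric0 z = - (1 / (4 * pi)) * lap (\<lambda>w. ln (rho0 w)) z"

text \<open>n = 1: Rbar = c_1(X) / [omega_0]\<close>
definition Rbar :: real where
  "Rbar = (\<integral>z. ric0 z \<partial>lborel) / (\<integral>z. rho0 z \<partial>lborel)"

text \<open>n = 1: E with dE = 2 omega_Phi, E^{Ric} with dE^{Ric} = Ric omega_0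
  (normalised to vanish at Phi_FS)\<close>
definition energyE :: "(complex \<Rightarrow> real) \<Rightarrow> real" where
  "energyE Phi = (\<integral>z. (Phi z - phiFS z) * (curv Phi z + rho0 z) \<partial>lborel)"

definition energyRic :: "(complex \<Rightarrow> real) \<Rightarrow> real" where
  "energyRic Phi = (\<integral>z. (Phi z - phiFS z) * ric0 z \<partial>lborel)"

definition entropy :: "(complex \<Rightarrow> real) \<Rightarrow> real" where
  "entropy Phi = (\<integral>z. curv Phi z * ln (curv Phi z / rho0 z) \<partial>lborel)"

text \<open>Chen-Tian formula, n = 1\<close>
definition Kenergy :: "(complex \<Rightarrow> real) \<Rightarrow> real" where
  "Kenergy Phi = Rbar / 2 * energyE Phi - energyRic Phi + entropy Phi"

text \<open>Aut(X,L) acts through GL(2,C) on C^2; a metric Phi corresponds to the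
log-homogeneous function Psi(Z0,Z1) = Phi(Z1/Z0) + log|Z0|^2, pulled back by g.\<close>
definition pullback :: "complex^2^2 \<Rightarrow> (complex \<Rightarrow> real) \<Rightarrow> complex \<Rightarrow> real" where
  "pullback g Phi z =
     (let w = g *v vector [1, z] in Phi (w $ 2 / w $ 1) + ln ((cmod (w $ 1))\<^sup>2))"

definition one_param_subgroup :: "(real \<Rightarrow> complex^2^2) \<Rightarrow> bool" where
  "one_param_subgroup g \<longleftrightarrow> continuous_on UNIV g \<and> g 0 = mat 1 \<and>
     (\<forall>s t. g (s + t) = g s ** g t)"

end

theory Submission
  imports Defs "HOL-Real_Asymp.Real_Asymp"
begin

text \<open>On S^1-invariant metrics the entropy part of the K-energy is, up to terms affine in the
Legendre transform u, the integral of - log u'', where only the absolutely continuous part of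
u'' counts. Hence it does not see kinks: adding to u_0 = y log y + (1 - y) log (1 - y) the
function t max(0, y - 1/2) yields a geodesic along which the K-energy is affine. On the side of
the metrics the kink becomes the annulus 1 < |z|^2 < exp t where the curvature vanishes, while the
metric is still C^{1,1}. The starting point is the Fubini--Study metric: the exponential of any of its
pull-backs is a quadratic polynomial in z, which cannot be 1 + |z|^2 on the disc and 2 |z| on the
annulus, so the geodesic is not induced by automorphisms.

The curvature density is only determined almost everywhere, so the computation
needs that the weak Laplacian is unique, which is tested against smooth bump functions.\<close>

subsection \<open>Bump functions and uniqueness of the weak Laplacian\<close>

text \<open>The kink sits at y = 1/2 because this is the slope s / (1 + s) of the Fubini-Study
  potential in log s at s = 1. Slopes below 1/2 stay where they are, slopes above are moved by t in
  log s, and the gap left between them is the annulus. The dual of a kink is an affine piece that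
  joins with matching slope, so only the second derivative of the potential jumps: the curvature has
  no mass on the two circles, and a finite exceptional set suffices when integrating by parts. The
  slope of the K-energy can be predicted on the dual side. The derivative of the profile carries the
  curvature to Lebesgue measure on [0,1], so the energy is -2 times the integral of t max(0, y -
  1/2), that is -t/4. Since Ric omega_0 = 2 omega_0 and the entropy is again an integral of the
  potential difference, the K-energy equals minus the energy, t/4. The value is confirmed below by
  explicit primitives in s = |z|^2.\<close>

coinductive smooth1 :: "(real \<Rightarrow> real) \<Rightarrow> bool" where
  smooth1I: "(\<And>x. (f has_real_derivative f' x) (at x)) \<Longrightarrow> smooth1 f' \<Longrightarrow> smooth1 f"

lemma smooth1_continuous: "smooth1 f \<Longrightarrow> continuous_on UNIV f"
  by (meson DERIV_isCont continuous_at_imp_continuous_on smooth1.cases)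

text \<open>Coinduction replaces formulas for the n-th derivative: it is enough to find a class
  around the given function in which every member has its derivative.\<close>

lemma smooth1_if_closed_under_deriv:
  assumes "P f" and "\<And>g. P g \<Longrightarrow> \<exists>g'. (\<forall>x. (g has_real_derivative g' x) (at x)) \<and> P g'"
  shows "smooth1 f"
  by (rule smooth1.coinduct[of P]) (use assms in blast)+

text \<open>A product alone is not stable under differentiation, but by the Leibniz rule finite sums
  of products are. This is the class for the coinduction in \<open>smooth1_mult\<close>.\<close>

inductive sum_of_products :: "(real \<Rightarrow> real) \<Rightarrow> bool" where
  prod: "smooth1 f \<Longrightarrow> smooth1 g \<Longrightarrow> sum_of_products (\<lambda>x. f x * g x)"
| add: "sum_of_products f \<Longrightarrow> sum_of_products g \<Longrightarrow> sum_of_products (\<lambda>x. f x + g x)"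

lemma sum_of_products_deriv:
  "sum_of_products f \<Longrightarrow> \<exists>f'. (\<forall>x. (f has_real_derivative f' x) (at x)) \<and> sum_of_products f'"
proof (induction rule: sum_of_products.induct)
  case (prod f g)
  from prod.hyps obtain f' g' where *: "\<And>x. (f has_real_derivative f' x) (at x)" "smooth1 f'"
    "\<And>x. (g has_real_derivative g' x) (at x)" "smooth1 g'"
    by (meson smooth1.cases)
  show ?case
    by (rule exI[of _ "\<lambda>x. f' x * g x + f x * g' x"])
      (auto intro!: derivative_eq_intros *(1,3) sum_of_products.intros prod.hyps *(2,4))
next
  case (add f g)
  then obtain f' g' where *: "\<And>x. (f has_real_derivative f' x) (at x)" "sum_of_products f'"
    "\<And>x. (g has_real_derivative g' x) (at x)" "sum_of_products g'"
    by blast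
  show ?case
    by (rule exI[of _ "\<lambda>x. f' x + g' x"])
      (auto intro!: derivative_eq_intros *(1,3) sum_of_products.intros *(2,4))
qed

lemma smooth1_mult:
  assumes "smooth1 f" "smooth1 g"
  shows "smooth1 (\<lambda>x. f x * g x)"
  by (rule smooth1_if_closed_under_deriv[of sum_of_products])
    (use assms in \<open>auto intro: sum_of_products.prod dest: sum_of_products_deriv\<close>)

lemma smooth1_affine:
  assumes "smooth1 f"
  shows "smooth1 (\<lambda>x. f (a * x + b))"
proof (rule smooth1_if_closed_under_deriv)
  \<comment> \<open>The factor \<open>k\<close> collects the powers of \<open>a\<close> that the
    chain rule produces.\<close>
  let ?P = "\<lambda>h. \<exists>k g. h = (\<lambda>x. k * g (a * x + b)) \<and> smooth1 g"
  show "?P (\<lambda>x. f (a * x + b))"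
    by (rule exI[of _ 1]) (use assms in auto)
  fix h assume "?P h"
  then obtain k g where h: "h = (\<lambda>x. k * g (a * x + b))" and g: "smooth1 g" by blast
  from g obtain g' where g': "\<And>x. (g has_real_derivative g' x) (at x)" "smooth1 g'"
    by (meson smooth1.cases)
  have "(h has_real_derivative (k * a) * g' (a * x + b)) (at x)" for x
    unfolding h by (auto intro!: derivative_eq_intros DERIV_chain2[OF g'(1)])
  then show "\<exists>h'. (\<forall>x. (h has_real_derivative h' x) (at x)) \<and> ?P h'"
    using g'(2) by (intro exI[of _ "\<lambda>x. (k * a) * g' (a * x + b)"]) blast
qed

text \<open>The classical function exp(-1/x), flat at 0, with a polynomial in 1/x in front so that
  the family is closed under differentiation. The bumps use p = 1.\<close>

definition flat_exp :: "real poly \<Rightarrow> real \<Rightarrow> real" where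
  "flat_exp p x = (if x > 0 then poly p (1 / x) * exp (- (1 / x)) else 0)"

lemma poly_mult_exp_minus_tendsto_0:
  "((\<lambda>y. poly p y * exp (- y)) \<longlongrightarrow> 0) (at_top :: real filter)"
proof -
  have "((\<lambda>y. \<Sum>i\<le>degree p. coeff p i * (y ^ i / exp y)) \<longlongrightarrow> 0) (at_top :: real filter)"
    by (intro tendsto_null_sum tendsto_mult_right_zero tendsto_power_div_exp_0)
  then show ?thesis
    by (simp add: poly_altdef sum_distrib_right exp_minus divide_inverse mult.assoc)
qed

text \<open>In y = 1/x the operator d/dx is -y^2 d/dy, which sends p(y) exp(-y) to y^2 (p - p')(y)
  exp(-y). At x = 0 the right difference quotient is y p(y) exp(-y), which tends to 0 as y
  grows.\<close>

lemma flat_exp_has_derivative: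
  "(flat_exp p has_real_derivative flat_exp ([:0, 0, 1:] * (p - pderiv p)) x) (at x)"
proof -
  consider "x > 0" | "x < 0" | "x = 0" by linarith
  then show ?thesis
  proof cases
    case 1
    have "((\<lambda>x. poly p (1 / x) * exp (- (1 / x))) has_real_derivative
        flat_exp ([:0, 0, 1:] * (p - pderiv p)) x) (at x)"
      using 1 by (auto intro!: derivative_eq_intros DERIV_chain2[OF poly_DERIV]
          simp: flat_exp_def field_simps power2_eq_square)
    then show ?thesis
      by (rule has_field_derivative_transform_within_open[of _ _ _ "{0<..}"])
        (use 1 in \<open>auto simp: flat_exp_def\<close>)
  next
    case 2
    have "((\<lambda>x. 0) has_real_derivative flat_exp ([:0, 0, 1:] * (p - pderiv p)) x) (at x)"
      using 2 by (auto simp: flat_exp_def)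
    then show ?thesis
      by (rule has_field_derivative_transform_within_open[of _ _ _ "{..<0}"])
        (use 2 in \<open>auto simp: flat_exp_def\<close>)
  next
    case 3
    have R: "((\<lambda>h. flat_exp p h / h) \<longlongrightarrow> 0) (at_right 0)"
    proof -
      have "((\<lambda>h::real. poly ([:0, 1:] * p) (inverse h) * exp (- inverse h)) \<longlongrightarrow> 0) (at_right 0)"
        by (rule filterlim_compose[OF poly_mult_exp_minus_tendsto_0 filterlim_inverse_at_top_right])
      then show ?thesis
        by (rule Lim_transform_eventually)
          (auto simp: eventually_at_right_less flat_exp_def field_simps
            intro!: eventually_mono[OF eventually_at_right_less[of 0]])
    qed
    have L: "((\<lambda>h. flat_exp p h / h) \<longlongrightarrow> 0) (at_left 0)"
      by (rule Lim_transform_eventually[OF tendsto_const])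
        (auto simp: flat_exp_def eventually_at_left_field intro!: exI[of _ "-1"])
    show ?thesis
      unfolding 3 DERIV_def using filterlim_split_at[OF L R] by (simp add: flat_exp_def)
  qed
qed

lemma smooth1_flat_exp: "smooth1 (flat_exp p)"
  by (rule smooth1_if_closed_under_deriv[of "\<lambda>f. \<exists>q. f = flat_exp q"])
    (use flat_exp_has_derivative in blast)+

text \<open>Products of a function of \<open>Re z\<close> and one of \<open>Im z\<close> are stable
  under both coordinate derivatives, so smoothness in the plane reduces to smoothness in one
  variable.\<close>

lemma foldr_dir_deriv_product:
  assumes "set ds \<subseteq> {1, \<i>}" "smooth1 a" "smooth1 b"
  shows "\<exists>a' b'. smooth1 a' \<and> smooth1 b' \<and>
    foldr dir_deriv ds (\<lambda>z. a (Re z) * b (Im z)) = (\<lambda>z. a' (Re z) * b' (Im z))"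
  using assms(1)
proof (induction ds)
  case Nil
  then show ?case using assms by auto
next
  case (Cons d ds)
  then obtain a1 b1 where ab: "smooth1 a1" "smooth1 b1"
    "foldr dir_deriv ds (\<lambda>z. a (Re z) * b (Im z)) = (\<lambda>z. a1 (Re z) * b1 (Im z))"
    by auto
  then obtain a2 b2 where ab2: "\<And>x. (a1 has_real_derivative a2 x) (at x)" "smooth1 a2"
    "\<And>x. (b1 has_real_derivative b2 x) (at x)" "smooth1 b2"
    by (meson smooth1.cases)
  from Cons.prems consider "d = 1" | "d = \<i>" by auto
  then show ?case
  proof cases
    case 1
    have "dir_deriv 1 (\<lambda>z. a1 (Re z) * b1 (Im z)) z = a2 (Re z) * b1 (Im z)" for z
      unfolding dir_deriv_def
      by (rule DERIV_imp_deriv) (auto intro!: derivative_eq_intros DERIV_chain2[OF ab2(1)])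
    then show ?thesis
      using 1 ab ab2 by (intro exI[of _ a2] exI[of _ b1]) auto
  next
    case 2
    have "dir_deriv \<i> (\<lambda>z. a1 (Re z) * b1 (Im z)) z = a1 (Re z) * b2 (Im z)" for z
      unfolding dir_deriv_def
      by (rule DERIV_imp_deriv) (auto intro!: derivative_eq_intros DERIV_chain2[OF ab2(3)])
    then show ?thesis
      using 2 ab ab2 by (intro exI[of _ a1] exI[of _ b2]) auto
  qed
qed

lemma smooth_fun_product:
  assumes "smooth1 a" "smooth1 b"
  shows "smooth_fun (\<lambda>z. a (Re z) * b (Im z))"
  unfolding smooth_fun_def
proof (intro allI impI conjI ballI)
  fix ds :: "complex list" assume "set ds \<subseteq> {1, \<i>}"
  from foldr_dir_deriv_product[OF this assms] obtain a' b' where ab: "smooth1 a'" "smooth1 b'"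
    and eq: "foldr dir_deriv ds (\<lambda>z. a (Re z) * b (Im z)) = (\<lambda>z. a' (Re z) * b' (Im z))"
    by blast
  show "continuous_on UNIV (foldr dir_deriv ds (\<lambda>z. a (Re z) * b (Im z)))"
    unfolding eq
    by (intro continuous_intros continuous_on_compose2[OF smooth1_continuous[OF ab(1)]]
        continuous_on_compose2[OF smooth1_continuous[OF ab(2)]]) auto
  fix v z :: complex assume "v \<in> {1, \<i>}"
  obtain a2 b2 where ab2: "\<And>x. (a' has_real_derivative a2 x) (at x)"
    "\<And>x. (b' has_real_derivative b2 x) (at x)"
    using ab by (meson smooth1.cases)
  have "((\<lambda>r. a' (Re z + r * Re v) * b' (Im z + r * Im v)) has_real_derivative
      a2 (Re z) * Re v * b' (Im z) + a' (Re z) * (b2 (Im z) * Im v)) (at 0)"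
    by (auto intro!: derivative_eq_intros DERIV_chain2[OF ab2(1)] DERIV_chain2[OF ab2(2)])
  then show "(\<lambda>r. foldr dir_deriv ds (\<lambda>z. a (Re z) * b (Im z)) (z + of_real r * v)) differentiable at 0"
    unfolding eq by (auto simp: real_differentiable_def)
qed

text \<open>The index steepens the edges and leaves the support alone: for every \<open>n\<close>
  the function is positive exactly on the interval from \<open>a\<close> to \<open>b\<close>, and it
  tends to the indicator of that open interval with values in [0,1], as dominated convergence
  wants.\<close>

definition bump :: "nat \<Rightarrow> real \<Rightarrow> real \<Rightarrow> real \<Rightarrow> real" where
  "bump n a b x = flat_exp 1 (real (Suc n) * (x - a)) * flat_exp 1 (real (Suc n) * (b - x))"

lemma smooth1_bump: "smooth1 (bump n a b)"
proof -
  have "smooth1 (\<lambda>x. flat_exp 1 (real (Suc n) * x + real (Suc n) * (- a)) *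
      flat_exp 1 (- real (Suc n) * x + real (Suc n) * b))"
    by (intro smooth1_mult smooth1_affine smooth1_flat_exp)
  then show ?thesis
    unfolding bump_def by (simp add: algebra_simps)
qed

lemma flat_exp_1_bounds: "0 \<le> flat_exp 1 x" "flat_exp 1 x \<le> 1" "flat_exp 1 x > 0 \<longleftrightarrow> x > 0"
  by (auto simp: flat_exp_def)

lemma bump_nonneg: "0 \<le> bump n a b x" and bump_le_1: "bump n a b x \<le> 1"
  unfolding bump_def using flat_exp_1_bounds by (auto intro!: mult_le_one)

lemma bump_pos_iff: "bump n a b x > 0 \<longleftrightarrow> a < x \<and> x < b"
proof -
  have "bump n a b x > 0 \<longleftrightarrow> flat_exp 1 (real (Suc n) * (x - a)) > 0 \<and> flat_exp 1 (real (Suc n) * (b - x)) > 0"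
    unfolding bump_def using flat_exp_1_bounds(1) by (metis less_le mult_eq_0_iff mult_pos_pos)
  then show ?thesis
    by (simp add: flat_exp_1_bounds(3) zero_less_mult_iff)
qed

lemma bump_eq_0_iff: "bump n a b x = 0 \<longleftrightarrow> \<not> (a < x \<and> x < b)"
  using bump_pos_iff[of n a b x] bump_nonneg[of n a b x] by linarith

lemma flat_exp_1_tendsto:
  "(\<lambda>n. flat_exp 1 (real (Suc n) * x)) \<longlonglongrightarrow> (if x > 0 then 1 else 0)"
proof (cases "x > 0")
  case True
  have "(\<lambda>n. exp (- (1 / (real (Suc n) * x)))) \<longlonglongrightarrow> 1"
    using True by real_asymp
  then show ?thesis using True by (auto simp: flat_exp_def)
next
  case False
  then show ?thesis by (simp add: flat_exp_def zero_less_mult_iff)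
qed

lemma bump_tendsto: "(\<lambda>n. bump n a b x) \<longlonglongrightarrow> indicator {a<..<b} x"
proof -
  have "(\<lambda>n. bump n a b x) \<longlonglongrightarrow> (if x - a > 0 then 1 else 0) * (if b - x > 0 then 1 else 0)"
    unfolding bump_def by (intro tendsto_mult flat_exp_1_tendsto)
  also have "(if x - a > 0 then 1 else 0) * (if b - x > 0 then 1 else 0) = (indicator {a<..<b} x :: real)"
    by (auto simp: indicator_def)
  finally show ?thesis .
qed

lemma test_fun_product:
  assumes "smooth1 f" "smooth1 g" "\<And>x. f x \<noteq> 0 \<Longrightarrow> \<bar>x\<bar> \<le> R" "\<And>x. g x \<noteq> 0 \<Longrightarrow> \<bar>x\<bar> \<le> R"
  shows "test_fun (\<lambda>z. f (Re z) * g (Im z))"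
  unfolding test_fun_def
proof (intro conjI smooth_fun_product assms)
  show "bounded {z. f (Re z) * g (Im z) \<noteq> 0}"
  proof (rule boundedI)
    fix z assume "z \<in> {z. f (Re z) * g (Im z) \<noteq> 0}"
    then show "norm z \<le> R + R"
      using cmod_le[of z] assms(3)[of "Re z"] assms(4)[of "Im z"] by auto
  qed
qed

text \<open>Boxes are stable under intersection and generate the Borel sets, and the sets over which
  \<open>g\<close> integrates to 0 form a Dynkin system. Hence \<open>g\<close> and 0 have the same
  integral over every Borel set.\<close>

lemma AE_zero_if_integral_box_zero:
  fixes g :: "'a::euclidean_space \<Rightarrow> real"
  assumes g: "integrable lborel g"
    and box: "\<And>a b. (\<integral>x. g x * indicator (box a b) x \<partial>lborel) = 0"
  shows "AE x in lborel. g x = 0"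
proof (rule density_unique_real)
  show "integrable lborel g" "integrable lborel (\<lambda>x::'a. 0 :: real)" using g by auto
  note [measurable] = borel_measurable_integrable[OF g]
  have int: "integrable lborel (\<lambda>x. g x * indicator A x)" if "A \<in> sets borel" for A
    using that by (intro integrable_real_mult_indicator g) auto
  \<comment> \<open>The whole space is not a box, but the complement step of the induction needs its
    integral; growing boxes exhaust it.\<close>
  have UNIV: "(\<integral>x. g x \<partial>lborel) = 0"
  proof -
    define B :: "nat \<Rightarrow> 'a set" where "B n = box (- real n *\<^sub>R One) (real n *\<^sub>R One)" for n
    have "(\<lambda>n. \<integral>x. g x * indicator (B n) x \<partial>lborel) \<longlonglongrightarrow> (\<integral>x. g x \<partial>lborel)"
    proof (rule integral_dominated_convergence)
      show "integrable lborel (\<lambda>x. norm (g x))" using g by simp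
      show "AE x in lborel. (\<lambda>n. g x * indicator (B n) x) \<longlonglongrightarrow> g x"
      proof (rule AE_I2)
        fix x :: 'a
        obtain N :: nat where N: "norm x < real N" using reals_Archimedean2 by blast
        have "x \<in> B n" if "n \<ge> N" for n
        proof -
          have "\<bar>x \<bullet> b\<bar> < real n" if "b \<in> Basis" for b
            using Basis_le_norm[OF that, of x] N \<open>n \<ge> N\<close> by linarith
          then show ?thesis by (auto simp: B_def box_def abs_less_iff) (smt (verit))
        qed
        then have "eventually (\<lambda>n. g x * indicator (B n) x = g x) sequentially"
          by (auto simp: eventually_sequentially intro!: exI[of _ N])
        then show "(\<lambda>n. g x * indicator (B n) x) \<longlonglongrightarrow> g x"
          by (rule tendsto_eventually)
      qed
    qed (auto simp: B_def indicator_def)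
    then show ?thesis
      using LIMSEQ_unique[OF _ tendsto_const] by (auto simp: B_def box)
  qed
  have "(\<integral>x. g x * indicator A x \<partial>lborel) = 0" if "A \<in> sets borel" for A
  proof -
    have sets: "sets borel = sigma_sets (UNIV :: 'a set) (range (\<lambda>(a, b). box a b))"
      by (subst borel_eq_box) simp
    have "Int_stable (range (\<lambda>(a, b). box a b :: 'a set))"
      by (auto simp: Int_stable_def box_Int_box)
    moreover have "range (\<lambda>(a, b). box a b :: 'a set) \<subseteq> Pow UNIV" by simp
    ultimately show ?thesis
      using that unfolding sets
    proof (induction rule: sigma_sets_induct_disjoint)
      case (basic A)
      then show ?case by (auto simp: box)
    next
      case empty
      then show ?case by simp
    next
      case (compl A)
      have "(\<integral>x. g x * indicator (UNIV - A) x \<partial>lborel) = (\<integral>x. g x - g x * indicator A x \<partial>lborel)"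
        by (intro Bochner_Integration.integral_cong) (auto simp: indicator_def)
      also have "\<dots> = 0"
        using compl sets by (subst Bochner_Integration.integral_diff) (auto simp: UNIV g int)
      finally show ?case .
    next
      case (union A)
      have A: "A i \<in> sets lborel" for i using union(2) sets by auto
      have "(\<integral>x\<in>(\<Union>i. A i). g x \<partial>lborel) = (\<Sum>i. \<integral>x\<in>A i. g x \<partial>lborel)"
      proof (rule lebesgue_integral_countable_add)
        show "set_integrable lborel (\<Union>i. A i) g"
          using int[of "\<Union>i. A i"] A unfolding set_integrable_def
          by (auto simp: mult.commute)
      qed (use A union(1) in \<open>auto simp: disjoint_family_on_def\<close>)
      then show ?case
        using union(3) by (simp add: set_lebesgue_integral_def mult.commute)
    qed
  qed
  then show "(\<integral>x\<in>A. g x \<partial>lborel) = (\<integral>x\<in>A. 0 \<partial>lborel)" if "A \<in> sets lborel" for A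
    using that by (simp add: set_lebesgue_integral_def mult.commute)
qed

text \<open>\<open>weak_lap\<close> gives integrability only against test functions, so the
  difference is first multiplied by the cutoff \<open>B N\<close>, which is positive exactly on the
  open square of half-width \<open>N\<close>. The product is integrable, its integrals over boxes
  are limits of integrals against test functions, and letting \<open>N\<close> run removes the
  cutoff.\<close>

lemma weak_lap_unique:
  assumes "weak_lap Phi f1" "weak_lap Phi f2"
  shows "AE z in lborel. f1 z = f2 z"
proof -
  define B :: "nat \<Rightarrow> complex \<Rightarrow> real"
    where "B N z = bump 0 (- real N) (real N) (Re z) * bump 0 (- real N) (real N) (Im z)" for N z
  have [measurable]: "f1 \<in> borel_measurable borel" "f2 \<in> borel_measurable borel"
    using assms by (auto simp: weak_lap_def)
  have bump_meas[measurable]: "bump n a b \<in> borel_measurable borel" for n a b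
    by (intro borel_measurable_continuous_onI smooth1_continuous smooth1_bump)
  have [measurable]: "Re \<in> borel_measurable borel" "Im \<in> borel_measurable borel"
    by (auto intro!: borel_measurable_continuous_onI continuous_intros)
  have int: "integrable lborel (\<lambda>z. (f1 z - f2 z) * chi z) \<and> (\<integral>z. (f1 z - f2 z) * chi z \<partial>lborel) = 0"
    if "test_fun chi" for chi
  proof -
    have "integrable lborel (\<lambda>z. f1 z * chi z)" "integrable lborel (\<lambda>z. f2 z * chi z)"
      "(\<integral>z. f1 z * chi z \<partial>lborel) = (\<integral>z. f2 z * chi z \<partial>lborel)"
      using assms that unfolding weak_lap_def by auto
    then show ?thesis by (simp add: left_diff_distrib)
  qed
  have B_test: "test_fun (B N)" for N
    unfolding B_def by (rule test_fun_product[where R = "real N"])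
      (auto intro: smooth1_bump simp: bump_eq_0_iff)
  have "AE z in lborel. (f1 z - f2 z) * B N z = 0" for N
  proof (rule AE_zero_if_integral_box_zero)
    show int_B: "integrable lborel (\<lambda>z. (f1 z - f2 z) * B N z)"
      using int[OF B_test] by simp
    fix a b :: complex
    define C where "C n z = bump n (Re a) (Re b) (Re z) * bump n (Im a) (Im b) (Im z)" for n z
    have [measurable]: "C n \<in> borel_measurable borel" "B N \<in> borel_measurable borel" for n
      unfolding C_def B_def by measurable
    have "(\<lambda>n. \<integral>z. (f1 z - f2 z) * B N z * C n z \<partial>lborel) \<longlonglongrightarrow>
        (\<integral>z. (f1 z - f2 z) * B N z * indicator (box a b) z \<partial>lborel)"
    proof (rule integral_dominated_convergence)
      show "integrable lborel (\<lambda>z. norm ((f1 z - f2 z) * B N z))" using int_B by simp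
      show "AE z in lborel. (\<lambda>n. (f1 z - f2 z) * B N z * C n z) \<longlonglongrightarrow>
          (f1 z - f2 z) * B N z * indicator (box a b) z"
      proof (rule AE_I2, rule tendsto_mult_left)
        fix z
        have "(\<lambda>n. C n z) \<longlonglongrightarrow> indicator {Re a<..<Re b} (Re z) * indicator {Im a<..<Im b} (Im z)"
          unfolding C_def by (intro tendsto_mult bump_tendsto)
        then show "(\<lambda>n. C n z) \<longlonglongrightarrow> indicator (box a b) z"
          by (auto simp: indicator_def in_box_complex_iff)
      qed
      have C: "\<bar>C n z\<bar> \<le> 1" for n z
        unfolding C_def using bump_nonneg bump_le_1 by (auto simp: abs_mult intro!: mult_le_one)
      show "AE z in lborel. norm ((f1 z - f2 z) * B N z * C n z) \<le> norm ((f1 z - f2 z) * B N z)" for n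
        using C by (auto simp: abs_mult intro!: mult_left_le)
    qed auto
    moreover have "(\<integral>z. (f1 z - f2 z) * B N z * C n z \<partial>lborel) = 0" for n
    proof -
      \<comment> \<open>Grouping the factors by coordinate shows that cutoff times approximate
        indicator is again a product of two one-variable bumps.\<close>
      have "test_fun (\<lambda>z. (bump 0 (- real N) (real N) (Re z) * bump n (Re a) (Re b) (Re z)) *
         (bump 0 (- real N) (real N) (Im z) * bump n (Im a) (Im b) (Im z)))"
        by (rule test_fun_product[where R = "real N"])
          (auto intro!: smooth1_mult smooth1_bump simp: bump_eq_0_iff)
      from int[OF this] show ?thesis
        by (simp add: B_def C_def mult_ac)
    qed
    ultimately show "(\<integral>z. (f1 z - f2 z) * B N z * indicator (box a b) z \<partial>lborel) = 0"
      by (simp add: LIMSEQ_const_iff)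
  qed
  then have "AE z in lborel. \<forall>N. (f1 z - f2 z) * B N z = 0"
    by (subst AE_all_countable) blast
  then show ?thesis
  proof (rule AE_mp, intro AE_I2 impI)
    fix z assume *: "\<forall>N. (f1 z - f2 z) * B N z = 0"
    obtain N :: nat where N: "cmod z < real N" using reals_Archimedean2 by blast
    have "\<bar>Re z\<bar> < real N" "\<bar>Im z\<bar> < real N"
      using N abs_Re_le_cmod[of z] abs_Im_le_cmod[of z] by linarith+
    then have "B N z \<noteq> 0"
      by (auto simp: B_def bump_eq_0_iff)
    then show "f1 z = f2 z" using * by auto
  qed
qed

subsection \<open>The weak Laplacian of a radial function\<close>

text \<open>Makes Fubini available on the plane, so that the weak Laplacian can be treated line by
  line. The two measures are compared on boxes.\<close>

lemma lborel_complex: "lborel = distr (lborel \<Otimes>\<^sub>M lborel) borel (\<lambda>(x, y). Complex x y)"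
proof (rule lborel_eqI)
  have [measurable]: "(\<lambda>(x, y). Complex x y) \<in> borel_measurable borel"
    unfolding Complex_eq case_prod_beta
    by (intro borel_measurable_continuous_onI continuous_intros)
  have meas: "(\<lambda>(x, y). Complex x y) \<in> borel_measurable (lborel \<Otimes>\<^sub>M lborel)"
    unfolding lborel_prod by simp
  show "sets (distr (lborel \<Otimes>\<^sub>M lborel) borel (\<lambda>(x, y). Complex x y)) = sets borel" by simp
  fix l u :: complex assume le: "\<And>b. b \<in> Basis \<Longrightarrow> l \<bullet> b \<le> u \<bullet> b"
  have "emeasure (distr (lborel \<Otimes>\<^sub>M lborel) borel (\<lambda>(x, y). Complex x y)) (box l u) =
      emeasure (lborel \<Otimes>\<^sub>M lborel) ({Re l<..<Re u} \<times> {Im l<..<Im u})"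
    by (subst emeasure_distr[OF meas])
      (auto simp: space_pair_measure in_box_complex_iff intro!: arg_cong2[where f = emeasure])
  also have "\<dots> = ennreal (Re u - Re l) * ennreal (Im u - Im l)"
    using le[of 1] le[of \<i>] by (subst lborel.emeasure_pair_measure_Times) (auto simp: Basis_complex_def)
  also have "\<dots> = ennreal (\<Prod>b\<in>Basis. (u - l) \<bullet> b)"
    using le[of 1] le[of \<i>] by (simp add: Basis_complex_def ennreal_mult)
  finally show "emeasure (distr (lborel \<Otimes>\<^sub>M lborel) borel (\<lambda>(x, y). Complex x y)) (box l u) =
      ennreal (\<Prod>b\<in>Basis. (u - l) \<bullet> b)" .
qed

lemma lborel_integral_complex:
  fixes g :: "complex \<Rightarrow> real"
  assumes g: "integrable lborel g"
  shows "(\<integral>z. g z \<partial>lborel) = (\<integral>x. (\<integral>y. g (Complex x y) \<partial>lborel) \<partial>lborel)"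
    and "(\<integral>z. g z \<partial>lborel) = (\<integral>y. (\<integral>x. g (Complex x y) \<partial>lborel) \<partial>lborel)"
proof -
  have "(\<lambda>(x, y). Complex x y) \<in> borel_measurable borel"
    unfolding Complex_eq case_prod_beta
    by (intro borel_measurable_continuous_onI continuous_intros)
  then have meas: "(\<lambda>(x, y). Complex x y) \<in> borel_measurable (lborel \<Otimes>\<^sub>M lborel)"
    unfolding lborel_prod by simp
  have gm: "g \<in> borel_measurable borel" using g by (auto dest: borel_measurable_integrable)
  have "integrable (lborel \<Otimes>\<^sub>M lborel) (\<lambda>p. g ((\<lambda>(x, y). Complex x y) p))"
    using g gm by (subst (asm) lborel_complex, subst (asm) integrable_distr_eq[OF meas]) auto
  moreover have g_eq: "(\<lambda>p. g ((\<lambda>(x, y). Complex x y) p)) = (\<lambda>(x, y). g (Complex x y))"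
    by auto
  ultimately have int: "integrable (lborel \<Otimes>\<^sub>M lborel) (\<lambda>(x, y). g (Complex x y))"
    by (simp only:)
  have eq: "(\<integral>z. g z \<partial>lborel) = integral\<^sup>L (lborel \<Otimes>\<^sub>M lborel) (\<lambda>(x, y). g (Complex x y))"
    by (subst lborel_complex, subst integral_distr[OF meas gm]) (simp only: g_eq)
  show "(\<integral>z. g z \<partial>lborel) = (\<integral>x. (\<integral>y. g (Complex x y) \<partial>lborel) \<partial>lborel)"
    unfolding eq by (rule lborel_pair.integral_fst[OF int, symmetric])
  show "(\<integral>z. g z \<partial>lborel) = (\<integral>y. (\<integral>x. g (Complex x y) \<partial>lborel) \<partial>lborel)"
    unfolding eq by (rule lborel_pair.integral_snd[OF int, symmetric])
qed

lemma integrable_bounded_times_compact_support: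
  fixes g c :: "'a::euclidean_space \<Rightarrow> real"
  assumes [measurable]: "g \<in> borel_measurable borel"
    and bnd: "\<And>x. norm x \<le> R \<Longrightarrow> \<bar>g x\<bar> \<le> K"
    and c: "continuous_on UNIV c" and supp: "\<And>x. norm x \<ge> R \<Longrightarrow> c x = 0"
  shows "integrable lborel (\<lambda>x. g x * c x)"
proof -
  have [measurable]: "c \<in> borel_measurable borel"
    using c by (rule borel_measurable_continuous_onI)
  have "integrable lborel (\<lambda>x. indicator (cball 0 R) x *\<^sub>R c x)"
    by (rule borel_integrable_compact) (auto intro: continuous_on_subset[OF c])
  also have "(\<lambda>x. indicator (cball 0 R) x *\<^sub>R c x) = c"
    using supp by (auto simp: indicator_def fun_eq_iff)
  finally have "integrable lborel (\<lambda>x. K * c x)" by simp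
  then show ?thesis
  proof (rule Bochner_Integration.integrable_bound)
    show "AE x in lborel. norm (g x * c x) \<le> norm (K * c x)"
    proof (rule AE_I2)
      fix x
      show "norm (g x * c x) \<le> norm (K * c x)"
      proof (cases "norm x \<le> R")
        case True
        with bnd[of x] have "\<bar>g x\<bar> \<le> \<bar>K\<bar>" by linarith
        then show ?thesis by (simp add: abs_mult mult_right_mono)
      qed (simp add: supp)
    qed
  qed simp
qed

text \<open>The derivative of F c' - F' c is F c'' - F'' c away from \<open>S\<close>. As F' is
  continuous, so is this primitive; the points of \<open>S\<close> then contribute no jump terms,
  and the boundary terms vanish with \<open>c\<close> and its derivative.\<close>

lemma integral_by_parts_twice:
  fixes F F1 F2 c c1 c2 :: "real \<Rightarrow> real"
  assumes F: "\<And>x. (F has_real_derivative F1 x) (at x)" and "continuous_on UNIV F1"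
    and F1: "\<And>x. x \<notin> S \<Longrightarrow> (F1 has_real_derivative F2 x) (at x)" and "finite S"
    and F2: "F2 \<in> borel_measurable borel" "\<And>x. \<bar>x\<bar> \<le> R \<Longrightarrow> \<bar>F2 x\<bar> \<le> K"
    and c: "\<And>x. (c has_real_derivative c1 x) (at x)"
    and c1: "\<And>x. (c1 has_real_derivative c2 x) (at x)" and c2: "continuous_on UNIV c2"
    and supp: "\<And>x. \<bar>x\<bar> \<ge> R \<Longrightarrow> c x = 0" "\<And>x. \<bar>x\<bar> \<ge> R \<Longrightarrow> c1 x = 0" "\<And>x. \<bar>x\<bar> \<ge> R \<Longrightarrow> c2 x = 0"
    and "R \<ge> 0"
  shows "(\<integral>x. F x * c2 x \<partial>lborel) = (\<integral>x. F2 x * c x \<partial>lborel)"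
proof -
  have contF: "continuous_on UNIV F" and contc: "continuous_on UNIV c" and contc1: "continuous_on UNIV c1"
    using F c c1 by (auto intro!: continuous_at_imp_continuous_on DERIV_isCont)
  have "compact (F ` cball 0 R)"
    by (intro compact_continuous_image continuous_on_subset[OF contF]) auto
  then obtain M where M: "\<forall>x\<in>cball 0 R. \<bar>F x\<bar> \<le> M"
    by (auto dest!: compact_imp_bounded simp: bounded_iff simp del: mem_cball)
  have int1: "integrable lborel (\<lambda>x. F x * c2 x)"
    by (rule integrable_bounded_times_compact_support[where R = R and K = M])
      (use M contF c2 supp in \<open>auto intro: borel_measurable_continuous_onI\<close>)
  have int2: "integrable lborel (\<lambda>x. F2 x * c x)"
    by (rule integrable_bounded_times_compact_support[where R = R and K = K])
      (use F2 contc supp in auto)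
  let ?G = "\<lambda>x. F x * c1 x - F1 x * c x"
  have "((\<lambda>x. F x * c2 x - F2 x * c x) has_integral (?G R - ?G (- R))) {-R..R}"
  proof (rule fundamental_theorem_of_calculus_interior_strong[OF \<open>finite S\<close>])
    show "continuous_on {- R..R} ?G"
      using contF contc contc1 \<open>continuous_on UNIV F1\<close>
      by (intro continuous_intros) (auto intro: continuous_on_subset)
    show "(?G has_vector_derivative F x * c2 x - F2 x * c x) (at x)" if "x \<in> {- R<..<R} - S" for x
      using that unfolding has_real_derivative_iff_has_vector_derivative[symmetric]
      by (auto intro!: derivative_eq_intros F F1 c c1)
  qed (use \<open>R \<ge> 0\<close> in auto)
  moreover have "?G R - ?G (- R) = 0" using supp \<open>R \<ge> 0\<close> by simp
  ultimately have "((\<lambda>x. F x * c2 x - F2 x * c x) has_integral 0) {-R..R}" by simp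
  then have "((\<lambda>x. F x * c2 x - F2 x * c x) has_integral 0) UNIV"
    by (rule has_integral_on_superset) (use supp in auto)
  moreover have "((\<lambda>x. F x * c2 x - F2 x * c x) has_integral
      (\<integral>x. F x * c2 x - F2 x * c x \<partial>lborel)) UNIV"
    using int1 int2 by (intro has_integral_integral_lborel) auto
  ultimately have "(\<integral>x. F x * c2 x - F2 x * c x \<partial>lborel) = 0"
    by (rule has_integral_unique[symmetric])
  then show ?thesis using int1 int2 by simp
qed

lemma test_fun_continuous: "test_fun chi \<Longrightarrow> continuous_on UNIV chi"
  unfolding test_fun_def smooth_fun_def by (auto dest!: spec[of _ "[]"])

lemma test_fun_support:
  assumes "test_fun chi"
  obtains R where "R \<ge> 0" "\<And>z. cmod z \<ge> R \<Longrightarrow> chi z = 0"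
proof -
  obtain B where B: "\<And>z. chi z \<noteq> 0 \<Longrightarrow> cmod z \<le> B"
    using assms unfolding test_fun_def bounded_iff by auto
  show ?thesis
  proof (rule that)
    show "max 0 B + 1 \<ge> 0" by simp
    show "chi z = 0" if "cmod z \<ge> max 0 B + 1" for z
      by (rule ccontr) (use B[of z] that in simp)
  qed
qed

text \<open>The definition of smoothness speaks of the parameter 0 on each line only; moving the
  base point along the line gives all parameters.\<close>

lemma test_fun_has_derivative_line:
  assumes "test_fun chi" "v \<in> {1, \<i>}"
  shows "((\<lambda>r. chi (z + of_real r * v)) has_real_derivative dir_deriv v chi (z + of_real r * v)) (at r)"
proof -
  have "\<forall>z. (\<lambda>r. chi (z + of_real r * v)) differentiable (at 0)"
    using assms unfolding test_fun_def smooth_fun_def by (auto dest!: spec[of _ "[]"])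
  then obtain D where "((\<lambda>u. chi ((z + of_real r * v) + of_real u * v)) has_real_derivative D) (at 0)"
    unfolding real_differentiable_def by blast
  moreover from this have "D = dir_deriv v chi (z + of_real r * v)"
    unfolding dir_deriv_def by (simp add: DERIV_imp_deriv)
  ultimately have "((\<lambda>u. chi (z + of_real (u + r) * v)) has_real_derivative
      dir_deriv v chi (z + of_real r * v)) (at 0)"
    by (simp add: algebra_simps)
  then show ?thesis
    using DERIV_shift[of "\<lambda>r. chi (z + of_real r * v)" _ 0 r] by simp
qed

lemma test_fun_dir_deriv:
  assumes "test_fun chi" "v \<in> {1, \<i>}"
  shows "test_fun (dir_deriv v chi)"
  unfolding test_fun_def
proof
  have eq: "foldr dir_deriv ds (dir_deriv v chi) = foldr dir_deriv (ds @ [v]) chi" for ds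
    by simp
  show "smooth_fun (dir_deriv v chi)"
    unfolding smooth_fun_def eq
  proof (intro allI impI)
    fix ds :: "complex list" assume "set ds \<subseteq> {1, \<i>}"
    then have "set (ds @ [v]) \<subseteq> {1, \<i>}" using assms(2) by simp
    then show "continuous_on UNIV (foldr dir_deriv (ds @ [v]) chi) \<and>
      (\<forall>u\<in>{1, \<i>}. \<forall>z. (\<lambda>r. foldr dir_deriv (ds @ [v]) chi (z + of_real r * u)) differentiable at 0)"
      using assms(1) unfolding test_fun_def smooth_fun_def by blast
  qed
  obtain R where R: "R \<ge> 0" "\<And>z. cmod z \<ge> R \<Longrightarrow> chi z = 0"
    using test_fun_support[OF assms(1)] by metis
  have "dir_deriv v chi z = 0" if z: "cmod z > R" for z
  proof -
    have "((\<lambda>r::real. chi (z + of_real r * v)) has_real_derivative 0) (at 0)"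
    proof (rule has_field_derivative_transform_within_open)
      show "((\<lambda>r. 0) has_real_derivative 0) (at 0)" by simp
      show "open {r::real. R < cmod (z + of_real r * v)}"
        by (intro open_Collect_less continuous_intros)
    qed (use z R in auto)
    then show ?thesis unfolding dir_deriv_def by (rule DERIV_imp_deriv)
  qed
  then have "{z. dir_deriv v chi z \<noteq> 0} \<subseteq> cball 0 R"
    by (force simp: not_less)
  then show "bounded {z. dir_deriv v chi z \<noteq> 0}"
    using bounded_cball bounded_subset by blast
qed

lemma cmod_square_has_derivative_line:
  "((\<lambda>r. (cmod (z + of_real r * v))\<^sup>2) has_real_derivative 2 * ((z + of_real r * v) \<bullet> v)) (at r)"
  unfolding cmod_power2 inner_complex_def
  by (auto intro!: derivative_eq_intros simp: algebra_simps)

lemma inner_has_derivative_line: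
  "((\<lambda>r. (z + of_real r * v) \<bullet> v) has_real_derivative (cmod v)\<^sup>2) (at r)"
  unfolding cmod_power2 inner_complex_def
  by (auto intro!: derivative_eq_intros simp: power2_eq_square)

text \<open>A line meets a circle where a monic quadratic polynomial vanishes. The circles on which
  the second radial derivative may fail thus leave finitely many exceptional points on each
  line.\<close>

lemma finite_cmod_square_on_line:
  assumes "cmod v = 1"
  shows "finite {r. (cmod (z + of_real r * v))\<^sup>2 = c}"
proof -
  have "(cmod (z + of_real r * v))\<^sup>2 = r\<^sup>2 + 2 * (z \<bullet> v) * r + (cmod z)\<^sup>2" for r
  proof -
    have "(cmod (z + of_real r * v))\<^sup>2 = r\<^sup>2 * (cmod v)\<^sup>2 + 2 * (z \<bullet> v) * r + (cmod z)\<^sup>2"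
      unfolding cmod_power2 inner_complex_def by (simp add: power2_eq_square algebra_simps)
    then show ?thesis using assms by simp
  qed
  then have "{r. (cmod (z + of_real r * v))\<^sup>2 = c} = {r. poly [:(cmod z)\<^sup>2 - c, 2 * (z \<bullet> v), 1:] r = 0}"
    by (auto simp: power2_eq_square algebra_simps)
  then show ?thesis
    using poly_roots_finite[of "[:(cmod z)\<^sup>2 - c, 2 * (z \<bullet> v), 1:]"] by simp
qed

text \<open>The classical formula 4 (h' + s h'') with s = |z|^2 holds weakly although h' may have
  corners: on every line parallel to an axis both derivatives are moved from the test function by
  parts, and Fubini assembles the lines.\<close>

lemma weak_lap_radial:
  fixes h h1 h2 :: "real \<Rightarrow> real"
  assumes h: "\<And>s. s \<ge> 0 \<Longrightarrow> (h has_real_derivative h1 s) (at s)"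
    and h1: "\<And>s. s \<ge> 0 \<Longrightarrow> s \<notin> S \<Longrightarrow> (h1 has_real_derivative h2 s) (at s)"
    and S: "finite S" and cont: "continuous_on {0..} h1"
    and h2[measurable]: "h2 \<in> borel_measurable borel"
    and bnd: "\<And>s. s \<ge> 0 \<Longrightarrow> \<bar>h1 s\<bar> \<le> K" "\<And>s. s \<ge> 0 \<Longrightarrow> \<bar>h2 s\<bar> \<le> K"
  shows "weak_lap (\<lambda>z. h ((cmod z)\<^sup>2)) (\<lambda>z. 4 * (h1 ((cmod z)\<^sup>2) + (cmod z)\<^sup>2 * h2 ((cmod z)\<^sup>2)))"
    (is "weak_lap ?Phi ?f")
proof -
  \<comment> \<open>The second derivative along the unit vector \<open>v\<close> off the exceptional
    circles. Summed over 1 and i, the squares of the inner products give |z|^2.\<close>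
  define d2 where "d2 v z = 2 * h1 ((cmod z)\<^sup>2) + 4 * (z \<bullet> v)\<^sup>2 * h2 ((cmod z)\<^sup>2)" for v z :: complex
  have f_eq: "?f = (\<lambda>z. d2 1 z + d2 \<i> z)"
    by (auto simp: d2_def fun_eq_iff inner_complex_def cmod_power2 algebra_simps)
  have h1_cont: "continuous_on UNIV (\<lambda>z. h1 ((cmod z)\<^sup>2))"
    by (rule continuous_on_compose2[OF cont]) (auto intro!: continuous_intros)
  have h_cont: "continuous_on {0..} h"
    using h by (auto intro!: continuous_at_imp_continuous_on DERIV_isCont)
  have Phi_cont: "continuous_on UNIV ?Phi"
    by (rule continuous_on_compose2[OF h_cont]) (auto intro!: continuous_intros)
  have [measurable]: "(\<lambda>z. h1 ((cmod z)\<^sup>2)) \<in> borel_measurable borel"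
    using h1_cont by (rule borel_measurable_continuous_onI)
  have d2_meas[measurable]: "d2 v \<in> borel_measurable borel" for v
    unfolding d2_def by measurable
  have K: "K \<ge> 0" using bnd(1)[of 0] by simp
  have d2_bnd: "\<bar>d2 v z\<bar> \<le> 2 * K + 4 * R\<^sup>2 * K" if "v \<in> {1, \<i>}" "cmod z \<le> R" for v z R
  proof -
    have "\<bar>z \<bullet> v\<bar> \<le> R"
      using that Cauchy_Schwarz_ineq2[of z v] by auto
    then have "(z \<bullet> v)\<^sup>2 \<le> R\<^sup>2"
      by (metis abs_ge_zero power2_abs power_mono)
    then have "(z \<bullet> v)\<^sup>2 * \<bar>h2 ((cmod z)\<^sup>2)\<bar> \<le> R\<^sup>2 * K"
      by (intro mult_mono bnd) auto
    moreover have "\<bar>d2 v z\<bar> \<le> 2 * \<bar>h1 ((cmod z)\<^sup>2)\<bar> + 4 * ((z \<bullet> v)\<^sup>2 * \<bar>h2 ((cmod z)\<^sup>2)\<bar>)"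
      unfolding d2_def by (rule order_trans[OF abs_triangle_ineq]) (simp add: abs_mult)
    ultimately show ?thesis using bnd(1)[of "(cmod z)\<^sup>2"] by simp
  qed
  have int_d2: "integrable lborel (\<lambda>z. d2 v z * chi z)" if chi: "test_fun chi" and v: "v \<in> {1, \<i>}" for chi v
  proof -
    obtain R where R: "R \<ge> 0" "\<And>z. cmod z \<ge> R \<Longrightarrow> chi z = 0"
      using test_fun_support[OF chi] by metis
    show ?thesis
      by (rule integrable_bounded_times_compact_support[where R = R and K = "2 * K + 4 * R\<^sup>2 * K"])
        (use R test_fun_continuous[OF chi] d2_bnd[OF v] in auto)
  qed
  have int_Phi: "integrable lborel (\<lambda>z. ?Phi z * chi z)" if chi: "test_fun chi" for chi
  proof -
    obtain R where R: "R \<ge> 0" "\<And>z. cmod z \<ge> R \<Longrightarrow> chi z = 0"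
      using test_fun_support[OF chi] by metis
    have "compact (?Phi ` cball 0 R)"
      by (intro compact_continuous_image continuous_on_subset[OF Phi_cont]) auto
    then obtain M where M: "\<forall>x\<in>cball 0 R. \<bar>?Phi x\<bar> \<le> M"
      by (auto dest!: compact_imp_bounded simp: bounded_iff simp del: mem_cball)
    show ?thesis
      by (rule integrable_bounded_times_compact_support[where R = R and K = M])
        (use R test_fun_continuous[OF chi] M Phi_cont in \<open>auto intro: borel_measurable_continuous_onI\<close>)
  qed
  have line: "(\<integral>r. ?Phi (z + of_real r * v) * dir_deriv v (dir_deriv v chi) (z + of_real r * v) \<partial>lborel) =
      (\<integral>r. d2 v (z + of_real r * v) * chi (z + of_real r * v) \<partial>lborel)"
    if chi: "test_fun chi" and v: "v \<in> {1, \<i>}" for chi v z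
  proof -
    have v1: "cmod v = 1" using v by auto
    note chi1 = test_fun_dir_deriv[OF chi v]
    note chi2 = test_fun_dir_deriv[OF chi1 v]
    obtain R where R: "R \<ge> 0" "\<And>z. cmod z \<ge> R \<Longrightarrow> chi z = 0"
      using test_fun_support[OF chi] by metis
    obtain R1 where R1: "R1 \<ge> 0" "\<And>z. cmod z \<ge> R1 \<Longrightarrow> dir_deriv v chi z = 0"
      using test_fun_support[OF chi1] by metis
    obtain R2 where R2: "R2 \<ge> 0" "\<And>z. cmod z \<ge> R2 \<Longrightarrow> dir_deriv v (dir_deriv v chi) z = 0"
      using test_fun_support[OF chi2] by metis
    \<comment> \<open>Beyond parameter \<open>Q\<close> the line has left the supports of the test
      function and of its first two derivatives along \<open>v\<close>.\<close>
    define Q where "Q = R + R1 + R2 + cmod z"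
    have Q: "cmod (z + of_real r * v) \<ge> R + R1 + R2" if "\<bar>r\<bar> \<ge> Q" for r
      using norm_triangle_ineq2[of "of_real r * v" "- z"] that
      by (simp add: Q_def norm_mult v1 add.commute)
    have Q': "cmod (z + of_real r * v) \<le> Q + cmod z" if "\<bar>r\<bar> \<le> Q" for r
      using norm_triangle_ineq[of z "of_real r * v"] that by (simp add: norm_mult v1)
    have line_cont: "continuous_on UNIV (\<lambda>r. z + of_real r * v)" by (intro continuous_intros)
    have line_meas[measurable]: "(\<lambda>r::real. z + of_real r * v) \<in> borel_measurable borel"
      using line_cont by (rule borel_measurable_continuous_onI)
    show ?thesis
    proof (rule integral_by_parts_twice)
      fix r :: real
      show "((\<lambda>r. ?Phi (z + of_real r * v)) has_real_derivative
          h1 ((cmod (z + of_real r * v))\<^sup>2) * (2 * ((z + of_real r * v) \<bullet> v))) (at r)"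
        by (rule DERIV_chain2[OF h cmod_square_has_derivative_line]) simp
      show "((\<lambda>r. chi (z + of_real r * v)) has_real_derivative dir_deriv v chi (z + of_real r * v)) (at r)"
        by (rule test_fun_has_derivative_line[OF chi v])
      show "((\<lambda>r. dir_deriv v chi (z + of_real r * v)) has_real_derivative
          dir_deriv v (dir_deriv v chi) (z + of_real r * v)) (at r)"
        by (rule test_fun_has_derivative_line[OF chi1 v])
    next
      show "continuous_on UNIV (\<lambda>r::real. dir_deriv v (dir_deriv v chi) (z + of_real r * v))"
        by (rule continuous_on_compose2[OF test_fun_continuous[OF chi2] line_cont]) auto
      show "continuous_on UNIV (\<lambda>r. h1 ((cmod (z + of_real r * v))\<^sup>2) * (2 * ((z + of_real r * v) \<bullet> v)))"
        by (intro continuous_intros continuous_on_compose2[OF h1_cont line_cont]) auto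
      show "finite (\<Union>c\<in>S. {r. (cmod (z + of_real r * v))\<^sup>2 = c})"
        using S finite_cmod_square_on_line[OF v1] by auto
      fix r assume r: "r \<notin> (\<Union>c\<in>S. {r. (cmod (z + of_real r * v))\<^sup>2 = c})"
      show "((\<lambda>r. h1 ((cmod (z + of_real r * v))\<^sup>2) * (2 * ((z + of_real r * v) \<bullet> v)))
          has_real_derivative d2 v (z + of_real r * v)) (at r)"
        using DERIV_mult[OF DERIV_chain2[OF h1 cmod_square_has_derivative_line, of z r v]
            DERIV_cmult[OF inner_has_derivative_line, of 2 z v r]] r v1
        by (simp add: d2_def power2_eq_square mult_ac add_ac)
    next
      show "(\<lambda>r. d2 v (z + of_real r * v)) \<in> borel_measurable borel" by measurable
      show "\<bar>d2 v (z + of_real r * v)\<bar> \<le> 2 * K + 4 * (Q + cmod z)\<^sup>2 * K" if "\<bar>r\<bar> \<le> Q" for r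
        using d2_bnd[OF v Q'[OF that]] .
      show "Q \<ge> 0" using R R1 R2 by (simp add: Q_def)
    qed (use Q R R1 R2 in \<open>smt (verit)\<close>)+
  qed
  have dir: "(\<integral>z. ?Phi z * dir_deriv v (dir_deriv v chi) z \<partial>lborel) = (\<integral>z. d2 v z * chi z \<partial>lborel)"
    if chi: "test_fun chi" and v: "v \<in> {1, \<i>}" for chi v
  proof -
    have int: "integrable lborel (\<lambda>z. ?Phi z * dir_deriv v (dir_deriv v chi) z)"
      by (intro int_Phi test_fun_dir_deriv chi v)
    note int' = int_d2[OF chi v]
    from v consider "v = 1" | "v = \<i>" by auto
    then show ?thesis
    proof cases
      case 1
      have C: "Complex x y = \<i> * of_real y + of_real x * v" for x y
        by (simp add: 1 complex_eq_iff)
      show ?thesis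
        unfolding lborel_integral_complex(2)[OF int] lborel_integral_complex(2)[OF int']
        unfolding C line[OF chi v] ..
    next
      case 2
      have C: "Complex x y = of_real x + of_real y * v" for x y
        by (simp add: 2 complex_eq_iff)
      show ?thesis
        unfolding lborel_integral_complex(1)[OF int] lborel_integral_complex(1)[OF int']
        unfolding C line[OF chi v] ..
    qed
  qed
  show ?thesis
    unfolding weak_lap_def f_eq
  proof (intro conjI allI impI)
    show "(\<lambda>z. d2 1 z + d2 \<i> z) \<in> borel_measurable lborel" by measurable
    fix chi assume chi: "test_fun chi"
    show "integrable lborel (\<lambda>z. (d2 1 z + d2 \<i> z) * chi z)"
      using int_d2[OF chi, of 1] int_d2[OF chi, of \<i>] by (simp add: distrib_right)
    have "(\<integral>z. ?Phi z * lap chi z \<partial>lborel) =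
        (\<integral>z. ?Phi z * dir_deriv 1 (dir_deriv 1 chi) z + ?Phi z * dir_deriv \<i> (dir_deriv \<i> chi) z \<partial>lborel)"
      by (simp add: lap_def distrib_left)
    also have "\<dots> = (\<integral>z. d2 1 z * chi z \<partial>lborel) + (\<integral>z. d2 \<i> z * chi z \<partial>lborel)"
      by (subst Bochner_Integration.integral_add)
        (auto intro!: int_Phi test_fun_dir_deriv chi dir arg_cong2[where f = plus])
    also have "\<dots> = (\<integral>z. (d2 1 z + d2 \<i> z) * chi z \<partial>lborel)"
      using int_d2[OF chi, of 1] int_d2[OF chi, of \<i>] by (simp add: distrib_right)
    finally show "(\<integral>z. ?Phi z * lap chi z \<partial>lborel) = (\<integral>z. (d2 1 z + d2 \<i> z) * chi z \<partial>lborel)" .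
  qed
qed

subsection \<open>Radial integrals and the Fubini--Study metric\<close>

text \<open>The disc |z|^2 <= a has area pi a, which is linear in a. This is why radial integrals
  are taken in s = |z|^2 rather than in the radius.\<close>

lemma distr_cmod_square:
  "distr lborel borel (\<lambda>z. (cmod z)\<^sup>2) = density lborel (\<lambda>s. ennreal pi * indicator {0..} s)"
proof (rule measure_eqI_generator_eq)
  let ?E = "range (\<lambda>a::real. {..a})"
  have meas[measurable]: "(\<lambda>z::complex. (cmod z)\<^sup>2) \<in> borel_measurable borel" by measurable
  show "Int_stable ?E" by (auto simp: Int_stable_def)
  show "?E \<subseteq> Pow UNIV" by simp
  show "sets (distr lborel borel (\<lambda>z. (cmod z)\<^sup>2)) = sigma_sets UNIV ?E"
    "sets (density lborel (\<lambda>s. ennreal pi * indicator {0..} s)) = sigma_sets UNIV ?E"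
    using borel_eq_atMost[where 'a = real] by (metis (no_types) sets_density sets_distr sets_lborel sets_measure_of subset_UNIV Pow_UNIV)+
  have L: "emeasure (distr lborel borel (\<lambda>z. (cmod z)\<^sup>2)) {..a} = ennreal (pi * max 0 a)" for a
  proof (cases "a \<ge> 0")
    case True
    have "emeasure (distr lborel borel (\<lambda>z. (cmod z)\<^sup>2)) {..a} = emeasure lborel (cball (0::complex) (sqrt a))"
    proof (subst emeasure_distr)
      have "(cmod z)\<^sup>2 \<le> a \<longleftrightarrow> cmod z \<le> sqrt a" for z
        using real_sqrt_le_iff[of "(cmod z)\<^sup>2" a] by simp
      then show "emeasure lborel ((\<lambda>z. (cmod z)\<^sup>2) -` {..a} \<inter> space lborel) =
          emeasure lborel (cball (0::complex) (sqrt a))"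
        by (auto intro!: arg_cong2[where f = emeasure])
    qed auto
    also have "\<dots> = ennreal (pi * a)"
      using True by (subst emeasure_cball) (auto simp: unit_ball_vol_2)
    finally show ?thesis using True by (simp add: max_def)
  next
    case False
    then have "\<not> (cmod z)\<^sup>2 \<le> a" for z
      using zero_le_power2[of "cmod z"] by linarith
    then have "(\<lambda>z. (cmod z)\<^sup>2) -` {..a} = {}" by auto
    with False show ?thesis by (subst emeasure_distr) (auto simp: max_def)
  qed
  show "emeasure (distr lborel borel (\<lambda>z. (cmod z)\<^sup>2)) X =
      emeasure (density lborel (\<lambda>s. ennreal pi * indicator {0..} s)) X" if "X \<in> ?E" for X
  proof -
    from that obtain a where X: "X = {..a}" by auto
    have "emeasure (density lborel (\<lambda>s. ennreal pi * indicator {0..} s)) X =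
        (\<integral>\<^sup>+s. ennreal pi * indicator {0..a} s \<partial>lborel)"
      by (subst emeasure_density) (auto simp: X intro!: nn_integral_cong split: split_indicator)
    also have "\<dots> = ennreal pi * emeasure lborel {0..a}"
      by (subst nn_integral_cmult_indicator) auto
    also have "\<dots> = ennreal (pi * max 0 a)"
      by (cases "a \<ge> 0") (auto simp: ennreal_mult max_def)
    finally show ?thesis using L[of a] X by simp
  qed
  show "range (\<lambda>n. {..real n}) \<subseteq> ?E" by auto
  show "(\<Union>n. {..real n}) = UNIV" by (auto simp: real_arch_simple)
  show "emeasure (distr lborel borel (\<lambda>z. (cmod z)\<^sup>2)) {..real n} \<noteq> \<infinity>" for n
    by (simp add: L)
qed

lemma nn_integral_radial:
  assumes [measurable]: "g \<in> borel_measurable borel"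
  shows "(\<integral>\<^sup>+z. ennreal (g ((cmod z)\<^sup>2)) \<partial>lborel) = ennreal pi * (\<integral>\<^sup>+s. ennreal (g s) * indicator {0..} s \<partial>lborel)"
proof -
  have [measurable]: "(\<lambda>z::complex. (cmod z)\<^sup>2) \<in> borel_measurable lborel" by measurable
  have "(\<integral>\<^sup>+z. ennreal (g ((cmod z)\<^sup>2)) \<partial>lborel) =
      (\<integral>\<^sup>+s. ennreal (g s) \<partial>distr lborel borel (\<lambda>z::complex. (cmod z)\<^sup>2))"
    by (subst nn_integral_distr) auto
  also have "\<dots> = (\<integral>\<^sup>+s. ennreal pi * (ennreal (g s) * indicator {0..} s) \<partial>lborel)"
    unfolding distr_cmod_square by (subst nn_integral_density) (auto simp: mult_ac)
  also have "\<dots> = ennreal pi * (\<integral>\<^sup>+s. ennreal (g s) * indicator {0..} s \<partial>lborel)"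
    by (rule nn_integral_cmult) auto
  finally show ?thesis .
qed

lemma has_bochner_integral_rho0: "has_bochner_integral lborel rho0 1"
proof (rule has_bochner_integral_nn_integral)
  have "(\<integral>\<^sup>+s. ennreal (1 / (pi * (1 + s)\<^sup>2)) * indicator {0..} s \<partial>lborel) = ennreal (0 - (- 1 / (pi * (1 + 0))))"
  proof (rule nn_integral_FTC_atLeast)
    show "((\<lambda>s. - 1 / (pi * (1 + s))) has_real_derivative 1 / (pi * (1 + s)\<^sup>2)) (at s)" if "0 \<le> s" for s
    proof -
      have "((\<lambda>s. - 1 / pi * inverse (1 + s)) has_real_derivative - 1 / pi * - inverse ((1 + s)\<^sup>2)) (at s)"
        using that by (auto intro!: derivative_eq_intros simp: power2_eq_square)
      then show ?thesis by (simp add: divide_inverse mult.commute)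
    qed
    show "((\<lambda>s. - 1 / (pi * (1 + s))) \<longlongrightarrow> 0) at_top" by real_asymp
  qed auto
  then have "(\<integral>\<^sup>+z. ennreal (rho0 z) \<partial>lborel) = ennreal pi * ennreal (1 / pi)"
    unfolding rho0_def by (subst nn_integral_radial[of "\<lambda>s. 1 / (pi * (1 + s)\<^sup>2)"]) auto
  also have "\<dots> = ennreal 1" by (subst ennreal_mult[symmetric]) auto
  finally show "(\<integral>\<^sup>+z. ennreal (rho0 z) \<partial>lborel) = ennreal 1" .
qed (auto simp: rho0_def[abs_def])

text \<open>The Fubini-Study form is Kaehler-Einstein. This lets the Ricci term of the K-energy
  combine with the energy.\<close>

lemma ric0_eq: "ric0 z = 2 * rho0 z"
proof -
  have pos: "1 + (cmod w)\<^sup>2 > 0" for w by (simp add: add_pos_nonneg)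
  have ln_rho0: "ln (rho0 w) = - ln pi - 2 * ln (1 + (cmod w)\<^sup>2)" for w
    using pos[of w] by (simp add: rho0_def ln_div ln_mult ln_realpow)
  have d1: "dir_deriv v (\<lambda>w. ln (rho0 w)) = (\<lambda>w. - 4 * (w \<bullet> v) / (1 + (cmod w)\<^sup>2))" for v
  proof
    fix w
    have "((\<lambda>r. ln (rho0 (w + of_real r * v))) has_real_derivative - 4 * (w \<bullet> v) / (1 + (cmod w)\<^sup>2)) (at 0)"
      unfolding ln_rho0
      using DERIV_diff[OF DERIV_const[of "- ln pi"] DERIV_cmult[OF DERIV_chain2[OF DERIV_ln
            DERIV_add[OF DERIV_const[of 1] cmod_square_has_derivative_line[of w v 0]]], of 2]] pos[of w]
      by (simp add: divide_inverse mult_ac)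
    then show "dir_deriv v (\<lambda>w. ln (rho0 w)) w = - 4 * (w \<bullet> v) / (1 + (cmod w)\<^sup>2)"
      unfolding dir_deriv_def by (rule DERIV_imp_deriv)
  qed
  have d2: "dir_deriv v (dir_deriv v (\<lambda>w. ln (rho0 w))) z =
      - 4 * (cmod v)\<^sup>2 / (1 + (cmod z)\<^sup>2) + 8 * (z \<bullet> v)\<^sup>2 / (1 + (cmod z)\<^sup>2)\<^sup>2" for v
  proof -
    have "((\<lambda>r. - 4 * ((z + of_real r * v) \<bullet> v) / (1 + (cmod (z + of_real r * v))\<^sup>2)) has_real_derivative
      (- 4 * (cmod v)\<^sup>2 * (1 + (cmod z)\<^sup>2) + 8 * (z \<bullet> v)\<^sup>2) / (1 + (cmod z)\<^sup>2)\<^sup>2) (at 0)"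
      using DERIV_divide[OF DERIV_cmult[OF inner_has_derivative_line[of z v 0], of "-4"]
          DERIV_add[OF DERIV_const[of 1] cmod_square_has_derivative_line[of z v 0]]] pos[of z]
      by (simp add: power2_eq_square mult_ac)
    then have "dir_deriv v (dir_deriv v (\<lambda>w. ln (rho0 w))) z =
      (- 4 * (cmod v)\<^sup>2 * (1 + (cmod z)\<^sup>2) + 8 * (z \<bullet> v)\<^sup>2) / (1 + (cmod z)\<^sup>2)\<^sup>2"
      unfolding d1 dir_deriv_def by (rule DERIV_imp_deriv)
    also have "\<dots> = - 4 * (cmod v)\<^sup>2 / (1 + (cmod z)\<^sup>2) + 8 * (z \<bullet> v)\<^sup>2 / (1 + (cmod z)\<^sup>2)\<^sup>2"
      using pos[of z] by (simp add: divide_simps) (simp add: power2_eq_square algebra_simps)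
    finally show ?thesis .
  qed
  have "lap (\<lambda>w. ln (rho0 w)) z = - 8 / (1 + (cmod z)\<^sup>2) + 8 * (cmod z)\<^sup>2 / (1 + (cmod z)\<^sup>2)\<^sup>2"
    unfolding lap_def d2 by (simp add: inner_complex_def cmod_power2 add_divide_distrib distrib_left)
  also have "\<dots> = - 8 / (1 + (cmod z)\<^sup>2)\<^sup>2"
  proof -
    have "- 8 / a + 8 * b / a\<^sup>2 = - 8 * (a - b) / a\<^sup>2" if "a \<noteq> 0" for a b :: real
      using that by (simp add: divide_simps) (simp add: algebra_simps power2_eq_square)
    from this[of "1 + (cmod z)\<^sup>2" "(cmod z)\<^sup>2"] pos[of z] show ?thesis by simp
  qed
  finally show ?thesis
    by (simp add: ric0_def rho0_def)
qed

lemma Rbar_eq: "Rbar = 2"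
  using has_bochner_integral_integral_eq[OF has_bochner_integral_rho0]
  by (simp add: Rbar_def ric0_eq)

subsection \<open>The geodesic and its curvature\<close>

text \<open>The metrics of the geodesic as functions of s = |z|^2, and their first two derivatives in s.
The slope in log s is constantly 1/2 on the annulus 1 \<le> s \<le> exp t: this is the kink that
t max(0, y - 1/2) adds to the Legendre transform.\<close>

definition geo :: "real \<Rightarrow> real \<Rightarrow> real" where
  "geo t s = (if s \<le> 1 then ln (1 + s) else if s \<le> exp t then ln 2 + ln s / 2
     else ln (exp t + s) - t / 2)"

definition geo1 :: "real \<Rightarrow> real \<Rightarrow> real" where
  "geo1 t s = (if s \<le> 1 then 1 / (1 + s) else if s \<le> exp t then 1 / (2 * s) else 1 / (exp t + s))"

definition geo2 :: "real \<Rightarrow> real \<Rightarrow> real" where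
  "geo2 t s = (if s \<le> 1 then - 1 / (1 + s)\<^sup>2 else if s \<le> exp t then - 1 / (2 * s\<^sup>2)
     else - 1 / (exp t + s)\<^sup>2)"

text \<open>Normalised with respect to ds, so that the curvature density on the plane is
geo_curv t (|z|^2) / \<pi>.\<close>

definition geo_curv :: "real \<Rightarrow> real \<Rightarrow> real" where
  "geo_curv t s = (if s \<le> 1 then 1 / (1 + s)\<^sup>2 else if s \<le> exp t then 0 else exp t / (exp t + s)\<^sup>2)"

text \<open>The hypotheses are conditional because a branch may be differentiable on its own side
  only, such as ln s, which occurs for s >= 1. At the junction the two one-sided derivatives are
  glued.\<close>

lemma DERIV_If:
  fixes f g :: "real \<Rightarrow> real"
  assumes f: "x \<le> a \<Longrightarrow> (f has_real_derivative D1) (at x)"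
    and g: "x \<ge> a \<Longrightarrow> (g has_real_derivative D2) (at x)"
    and eq: "x = a \<Longrightarrow> f a = g a \<and> D1 = D2"
  shows "((\<lambda>x. if x \<le> a then f x else g x) has_real_derivative (if x \<le> a then D1 else D2)) (at x)"
proof -
  have 1: ?thesis if "x < a"
  proof (rule has_field_derivative_transform_within_open)
    show "(f has_real_derivative (if x \<le> a then D1 else D2)) (at x)" using f that by simp
    show "open {..<a}" by simp
  qed (use that in auto)
  have 2: ?thesis if "x > a"
  proof (rule has_field_derivative_transform_within_open)
    show "(g has_real_derivative (if x \<le> a then D1 else D2)) (at x)" using g that by simp
    show "open {a<..}" by simp
  qed (use that in auto)
  have 3: ?thesis if x: "x = a"
  proof -
    let ?h = "\<lambda>x. if x \<le> a then f x else g x"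
    have "(?h has_real_derivative D1) (at a within {..a})"
    proof (rule has_field_derivative_transform_within)
      show "(f has_real_derivative D1) (at a within {..a})"
        using f x by (simp add: has_field_derivative_at_within)
      show "0 < (1::real)" by simp
    qed auto
    moreover have "(?h has_real_derivative D1) (at a within {a..})"
    proof (rule has_field_derivative_transform_within)
      show "(g has_real_derivative D1) (at a within {a..})"
        using g eq x by (simp add: has_field_derivative_at_within)
      show "0 < (1::real)" by simp
    qed (use eq x in auto)
    ultimately have "(?h has_real_derivative D1) (at a within {..a} \<union> {a..})"
      unfolding has_field_derivative_iff by (rule Lim_Un)
    moreover have "{..a} \<union> {a..} = UNIV" by auto
    ultimately show ?thesis using x by simp
  qed
  show ?thesis using 1 3 2 by (rule linorder_cases)
qed

text \<open>Values and slopes match at both junctions: they are ln 2 and 1/2 at s = 1, and ln 2 +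
  t/2 and 1 / (2 exp t) at s = exp t.\<close>

lemma geo_has_derivative:
  assumes "t \<ge> 0" "s \<ge> 0"
  shows "(geo t has_real_derivative geo1 t s) (at s)"
proof -
  have "exp t + s > 0" using assms by (simp add: add_pos_nonneg)
  moreover have "ln (exp t + exp t) = ln 2 + t"
    using ln_mult[of 2 "exp t"] by simp
  ultimately show ?thesis
    unfolding geo_def[abs_def] geo1_def
    by (intro DERIV_If) (use assms in \<open>auto intro!: derivative_eq_intros\<close>)
qed

lemma geo1_has_derivative:
  assumes "t \<ge> 0" "s \<ge> 0" "s \<notin> {1, exp t}"
  shows "(geo1 t has_real_derivative geo2 t s) (at s)"
proof -
  have "exp t + s \<noteq> 0" "1 + s \<noteq> 0" using assms by (auto simp: add_nonneg_eq_0_iff)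
  then show ?thesis
    unfolding geo1_def[abs_def] geo2_def
    by (intro DERIV_If) (use assms in \<open>auto intro!: derivative_eq_intros simp: power2_eq_square\<close>)
qed

lemma geo1_continuous: "t \<ge> 0 \<Longrightarrow> continuous_on {0..} (geo1 t)"
proof -
  assume t: "t \<ge> 0"
  then have "exp t \<ge> 1" by simp
  \<comment> \<open>Clamping \<open>s\<close> to the interval from 1 to \<open>exp t\<close> covers
    the three branches by one continuous formula.\<close>
  then have "geo1 t = (\<lambda>s. 1 / (s + max 1 (min s (exp t))))"
    by (auto simp: geo1_def fun_eq_iff max_def min_def simp del: one_le_exp_iff)
  moreover have "continuous_on {0..} (\<lambda>s. 1 / (s + max 1 (min s (exp t))))"
    by (intro continuous_intros) (auto simp: max_def add_nonneg_eq_0_iff)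
  ultimately show ?thesis by simp
qed

lemma exp_plus_ge_1: "t \<ge> 0 \<Longrightarrow> s \<ge> 0 \<Longrightarrow> exp t + s \<ge> (1::real)"
  using one_le_exp_iff[of t] by linarith

lemma weak_lap_geo:
  assumes "t \<ge> 0"
  shows "weak_lap (\<lambda>z. geo t ((cmod z)\<^sup>2)) (\<lambda>z. 4 * geo_curv t ((cmod z)\<^sup>2))"
proof -
  have "weak_lap (\<lambda>z. geo t ((cmod z)\<^sup>2)) (\<lambda>z. 4 * (geo1 t ((cmod z)\<^sup>2) + (cmod z)\<^sup>2 * geo2 t ((cmod z)\<^sup>2)))"
  proof (rule weak_lap_radial)
    show "finite {1, exp t}" by simp
    show "geo2 t \<in> borel_measurable borel" unfolding geo2_def[abs_def] by measurable
    show "\<bar>geo1 t s\<bar> \<le> 1" if "s \<ge> 0" for s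
      using that exp_plus_ge_1[OF assms that] by (auto simp: geo1_def field_simps)
    show "\<bar>geo2 t s\<bar> \<le> 1" if "s \<ge> 0" for s
    proof -
      have "1 \<le> (1 + s)\<^sup>2" "1 \<le> (exp t + s)\<^sup>2" "s > 1 \<Longrightarrow> 1 \<le> s\<^sup>2"
        using that exp_plus_ge_1[OF assms that] by (auto intro!: one_le_power)
      moreover from this have "s > 1 \<Longrightarrow> 1 \<le> 2 * s\<^sup>2" by linarith
      ultimately show ?thesis by (simp add: geo2_def divide_le_eq)
    qed
  qed (use assms geo_has_derivative geo1_has_derivative geo1_continuous in auto)
  \<comment> \<open>The left side is the derivative of s * \<open>geo1 t s\<close>, the slope in log
    s, which is constant on the annulus.\<close>
  moreover have "geo1 t s + s * geo2 t s = geo_curv t s" if "s \<ge> 0" for s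
  proof -
    have "1 + s \<noteq> 0" "exp t + s \<noteq> 0" using that exp_plus_ge_1[OF assms that] by auto
    moreover have "1 / a + s * (- 1 / a\<^sup>2) = (a - s) / a\<^sup>2" if "a \<noteq> 0" for a
      using that by (simp add: divide_simps) (simp add: algebra_simps power2_eq_square)
    ultimately show ?thesis
      by (simp add: geo1_def geo2_def geo_curv_def power2_eq_square)
  qed
  ultimately show ?thesis by simp
qed

text \<open>\<open>curv\<close> is built from an arbitrarily chosen weak Laplacian. Uniqueness
  identifies it almost everywhere, while measurability comes from the chosen function being a weak
  Laplacian.\<close>

lemma curv_geo:
  assumes "t \<ge> 0"
  shows "AE z in lborel. curv (\<lambda>z. geo t ((cmod z)\<^sup>2)) z = geo_curv t ((cmod z)\<^sup>2) / pi"
    and "curv (\<lambda>z. geo t ((cmod z)\<^sup>2)) \<in> borel_measurable lborel"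
proof -
  let ?f = "SOME f. weak_lap (\<lambda>z. geo t ((cmod z)\<^sup>2)) f"
  have f: "weak_lap (\<lambda>z. geo t ((cmod z)\<^sup>2)) ?f"
    by (rule someI[of "weak_lap _"]) (rule weak_lap_geo[OF assms])
  show "AE z in lborel. curv (\<lambda>z. geo t ((cmod z)\<^sup>2)) z = geo_curv t ((cmod z)\<^sup>2) / pi"
    using weak_lap_unique[OF f weak_lap_geo[OF assms]] by eventually_elim (simp add: curv_def)
  show "curv (\<lambda>z. geo t ((cmod z)\<^sup>2)) \<in> borel_measurable lborel"
    using f unfolding weak_lap_def curv_def[abs_def] by auto
qed

text \<open>The constant \<open>exp t\<close> is the limit at infinity of the ratio to the
  Fubini-Study density.\<close>

lemma geo_curv_bounds:
  assumes "t \<ge> 0" "s \<ge> 0"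
  shows "0 \<le> geo_curv t s" "geo_curv t s \<le> exp t * (1 / (1 + s)\<^sup>2)"
proof -
  show "0 \<le> geo_curv t s" by (simp add: geo_curv_def)
  have "1 + s \<le> exp t + s" using assms by simp
  then have "(1 + s)\<^sup>2 \<le> (exp t + s)\<^sup>2" using assms by (intro power_mono) auto
  then have "exp t / (exp t + s)\<^sup>2 \<le> exp t / (1 + s)\<^sup>2"
    using assms by (intro divide_left_mono) (auto simp: add_nonneg_pos add_nonneg_eq_0_iff zero_less_mult_iff)
  moreover have "1 / (1 + s)\<^sup>2 \<le> exp t / (1 + s)\<^sup>2"
    using assms by (intro divide_right_mono) auto
  ultimately show "geo_curv t s \<le> exp t * (1 / (1 + s)\<^sup>2)"
    by (auto simp: geo_curv_def)
qed

text \<open>The inequality of arithmetic and geometric means. In x = log s it puts the tangent at 0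
  below the convex function log(1 + exp x).\<close>

lemma ln_two_sqrt_le: "s > 0 \<Longrightarrow> ln 2 + ln s / 2 \<le> ln (1 + s :: real)"
proof -
  assume s: "s > 0"
  have "ln 2 + ln s / 2 = ln (2 * sqrt s)" using s by (simp add: ln_mult ln_sqrt)
  also have "2 * sqrt s \<le> 1 + s"
    using arith_geo_mean_sqrt[of 1 s] s by simp
  then have "ln (2 * sqrt s) \<le> ln (1 + s)" using s by simp
  finally show ?thesis .
qed

text \<open>Legendre duality reverses order, and the added function t max(0, y - 1/2) lies between 0
  and t/2 on [0,1]; the direct proof below compares branch by branch.\<close>

lemma geo_FS_bounds:
  assumes t: "t \<ge> 0" and s: "s \<ge> 0"
  shows "geo t s \<le> ln (1 + s)" "ln (1 + s) - t / 2 \<le> geo t s"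
proof -
  have e: "exp t \<ge> 1" using t by simp
  have up: "ln (exp t + s) - t / 2 \<le> ln (1 + s)" if "s > exp t"
  proof -
    \<comment> \<open>After exponentiation the claim is q^2 + s <= q (1 + s), and the difference of
      the two sides is (q - 1)(s - q).\<close>
    define q where "q = exp (t / 2)"
    have q: "q \<ge> 1" "exp t = q\<^sup>2" using t by (auto simp: q_def power2_eq_square simp flip: exp_add)
    have "q \<le> q\<^sup>2" using q by (simp add: power2_eq_square)
    then have "0 \<le> (q - 1) * (s - q)" using q that by auto
    then have "exp t + s \<le> q * (1 + s)" by (simp add: q algebra_simps power2_eq_square)
    then have "ln (exp t + s) \<le> ln (q * (1 + s))" using s q
      by (subst ln_le_cancel_iff) (auto intro!: add_pos_nonneg mult_pos_pos)
    also have "\<dots> = t / 2 + ln (1 + s)" using s by (simp add: q_def ln_mult)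
    finally show ?thesis by simp
  qed
  show "geo t s \<le> ln (1 + s)"
    using ln_two_sqrt_le[of s] up by (auto simp: geo_def)
  have "ln (1 + s) - t / 2 \<le> ln 2 + ln s / 2" if "1 < s" "s \<le> exp t"
  proof -
    have "ln (1 + s) \<le> ln (2 * s)" using that by simp
    also have "\<dots> = ln 2 + ln s" using that by (simp add: ln_mult)
    finally have "ln (1 + s) \<le> ln 2 + ln s" .
    moreover have "ln s \<le> t" using that by (metis ln_exp ln_le_cancel_iff exp_gt_zero order_less_trans zero_less_one)
    ultimately show ?thesis by simp
  qed
  moreover have "ln (1 + s) \<le> ln (exp t + s)"
    using s t by (subst ln_le_cancel_iff) (auto intro: add_pos_nonneg)
  ultimately show "ln (1 + s) - t / 2 \<le> geo t s" using t by (auto simp: geo_def)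
qed

lemma geo_continuous: "t \<ge> 0 \<Longrightarrow> continuous_on UNIV (\<lambda>z. geo t ((cmod z)\<^sup>2))"
proof (rule continuous_on_compose2[of "{0..}" "geo t"])
  assume "t \<ge> 0"
  then show "continuous_on {0..} (geo t)"
    by (intro continuous_at_imp_continuous_on ballI DERIV_isCont[OF geo_has_derivative]) auto
qed (auto intro!: continuous_intros)

lemma H11_geo:
  assumes "t \<ge> 0"
  shows "H11 (\<lambda>z. geo t ((cmod z)\<^sup>2))"
  unfolding H11_def
proof (intro conjI)
  show "continuous_on UNIV (\<lambda>z. geo t ((cmod z)\<^sup>2))" by (rule geo_continuous[OF assms])
  show "bounded (range (\<lambda>z. geo t ((cmod z)\<^sup>2) - phiFS z))"
  proof (rule boundedI)
    fix x assume "x \<in> range (\<lambda>z. geo t ((cmod z)\<^sup>2) - phiFS z)"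
    then obtain z where x: "x = geo t ((cmod z)\<^sup>2) - ln (1 + (cmod z)\<^sup>2)" by (auto simp: phiFS_def)
    show "norm x \<le> t / 2"
      using geo_FS_bounds[OF assms, of "(cmod z)\<^sup>2"] assms by (simp add: x)
  qed
  show "\<exists>f. weak_lap (\<lambda>z. geo t ((cmod z)\<^sup>2)) f \<and> (AE z in lborel. 0 \<le> f z) \<and>
      (\<exists>C. AE z in lborel. f z / (4 * pi) \<le> C * rho0 z)"
  proof (intro exI conjI AE_I2)
    show "weak_lap (\<lambda>z. geo t ((cmod z)\<^sup>2)) (\<lambda>z. 4 * geo_curv t ((cmod z)\<^sup>2))"
      by (rule weak_lap_geo[OF assms])
    fix z :: complex
    show "0 \<le> 4 * geo_curv t ((cmod z)\<^sup>2)"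
      using geo_curv_bounds(1)[OF assms] by simp
    show "4 * geo_curv t ((cmod z)\<^sup>2) / (4 * pi) \<le> exp t * rho0 z"
      using divide_right_mono[OF geo_curv_bounds(2)[OF assms, of "(cmod z)\<^sup>2"], of pi]
      by (simp add: rho0_def mult.commute)
  qed
qed

text \<open>Up to sign this is the energy, hence twice the integral of t max(0, y - 1/2) over [0,1],
  that is 2 * t/8. The integrand is nonnegative, so the extended integral yields integrability
  together with the value.\<close>

lemma geo_minus_FS_radial_integral:
  assumes t: "t \<ge> 0"
  shows "(\<integral>\<^sup>+s. ennreal ((ln (1 + s) - geo t s) * (geo_curv t s + 1 / (1 + s)\<^sup>2)) * indicator {0..} s \<partial>lborel)
    = ennreal (t / 4)"
proof -
  let ?f = "\<lambda>s. (ln (1 + s) - geo t s) * (geo_curv t s + 1 / (1 + s)\<^sup>2)"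
  define f1 where "f1 s = (ln (1 + s) - (ln 2 + ln s / 2)) * (1 / (1 + s)\<^sup>2)" for s :: real
  define f2 where "f2 s = (ln (1 + s) - (ln (exp t + s) - t / 2)) * (exp t / (exp t + s)\<^sup>2 + 1 / (1 + s)\<^sup>2)" for s :: real
  define F1 where "F1 s = (ln (1 + s) - (ln 2 + ln s / 2)) * (1 / 2 + s / (1 + s))
      + (ln s / 4 - (ln (1 + s) + 1 / (1 + s)))" for s :: real
  define F2 where "F2 s = (ln (1 + s) - (ln (exp t + s) - t / 2)) * (s / (exp t + s) + s / (1 + s))
      + (ln (exp t + s) + exp t / (exp t + s) - (ln (1 + s) + 1 / (1 + s)))" for s :: real
  have e: "exp t \<ge> 1" using t by simp
  have [measurable]: "f1 \<in> borel_measurable borel" "f2 \<in> borel_measurable borel"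
    unfolding f1_def f2_def by measurable
  \<comment> \<open>F1 and F2 come from integrating D (y_t + y_0)' by parts, where D is the difference of the
    potentials and y = s (d/ds) of a potential: s D' = y_t - y_0 up to sign, so what remains is
    the integral of (y_t^2 - y_0^2) / s.\<close>
  have combine: "p + c * a + d = a * c" if "p + d = (0::real)" for p a c d
    using that by (simp add: mult.commute)
  have d1: "(F1 has_real_derivative f1 s) (at s) \<and> 0 \<le> f1 s" if s: "1 \<le> s" for s
  proof -
    have nn: "0 \<le> f1 s" using ln_two_sqrt_le[of s] s by (simp add: f1_def)
    have D: "(F1 has_real_derivative ((1 / (1 + s) - 1 / s / 2) * (1 / 2 + s / (1 + s))
        + 1 / (1 + s)\<^sup>2 * (ln (1 + s) - (ln 2 + ln s / 2))
        + (1 / s / 4 - (1 / (1 + s) - 1 / (1 + s)\<^sup>2)))) (at s)"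
      unfolding F1_def[abs_def] using s
      by (auto intro!: derivative_eq_intros simp: power2_eq_square) (simp add: field_simps)
    have Z: "(1 / (1 + s) - 1 / s / 2) * (1 / 2 + s / (1 + s)) + (1 / s / 4 - (1 / (1 + s) - 1 / (1 + s)\<^sup>2)) = 0"
      using s by (simp add: divide_simps) (simp add: algebra_simps power2_eq_square)
    have "(F1 has_real_derivative f1 s) (at s)"
      by (rule DERIV_cong[OF D]) (unfold f1_def, rule combine[OF Z])
    with nn show ?thesis by blast
  qed
  have d2: "(F2 has_real_derivative f2 s) (at s) \<and> 0 \<le> f2 s" if s: "exp t \<le> s" for s
  proof -
    have s': "s \<ge> 1" using e s by linarith
    have pos: "exp t + s > 0" "1 + s > 0" using s' by (auto simp: add_pos_pos)
    have D: "(F2 has_real_derivative ((1 / (1 + s) - 1 / (exp t + s)) * (s / (exp t + s) + s / (1 + s))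
        + (exp t / (exp t + s)\<^sup>2 + 1 / (1 + s)\<^sup>2) * (ln (1 + s) - (ln (exp t + s) - t / 2))
        + (1 / (exp t + s) - exp t / (exp t + s)\<^sup>2 - (1 / (1 + s) - 1 / (1 + s)\<^sup>2)))) (at s)"
      unfolding F2_def[abs_def] using pos
      by (auto intro!: derivative_eq_intros simp: power2_eq_square)
    have Z: "(1 / (1 + s) - 1 / (exp t + s)) * (s / (exp t + s) + s / (1 + s))
        + (1 / (exp t + s) - exp t / (exp t + s)\<^sup>2 - (1 / (1 + s) - 1 / (1 + s)\<^sup>2)) = 0"
      using pos by (simp add: divide_simps) (simp add: algebra_simps power2_eq_square)
    have F2: "(F2 has_real_derivative f2 s) (at s)"
      by (rule DERIV_cong[OF D]) (unfold f2_def, rule combine[OF Z])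
    have "ln (exp t + s) - t / 2 \<le> ln (1 + s)"
    proof (cases "s = exp t")
      case True
      then show ?thesis using ln_two_sqrt_le[of s] ln_mult[of 2 "exp t"] by simp
    next
      case False
      then show ?thesis using geo_FS_bounds(1)[OF t, of s] s s' e by (auto simp: geo_def split: if_splits)
    qed
    then have "0 \<le> f2 s" by (simp add: f2_def)
    with F2 show ?thesis by blast
  qed
  \<comment> \<open>The difference of potentials tends to t/2, its factor to 2, and the remaining
    terms to 0.\<close>
  have lim: "(F2 \<longlongrightarrow> t) at_top"
  proof -
    have "((\<lambda>s. (ln (1 + s) - (ln (E + s) - t / 2)) * (s / (E + s) + s / (1 + s))
      + (ln (E + s) + E / (E + s) - (ln (1 + s) + 1 / (1 + s)))) \<longlongrightarrow> t) at_top" if "E > 0" for E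
      using that by real_asymp
    then show ?thesis unfolding F2_def[abs_def] by simp
  qed
  \<comment> \<open>Both increments must be known to be nonnegative before their sum can be formed
    in \<open>ennreal\<close>.\<close>
  have "F1 1 \<le> F1 (exp t)"
    by (rule DERIV_nonneg_imp_nondecreasing[OF e]) (use d1 in blast)
  moreover have "F2 (exp t) \<le> t"
  proof (rule tendsto_lowerbound[OF lim])
    show "eventually (\<lambda>s. F2 (exp t) \<le> F2 s) at_top"
      using eventually_ge_at_top[of "exp t"]
    proof eventually_elim
      case (elim s)
      show ?case
        by (rule DERIV_nonneg_imp_nondecreasing[OF elim]) (use d2 in blast)
    qed
  qed simp
  \<comment> \<open>The difference of potentials vanishes at 1 and has the same factor in
    \<open>F1\<close> and \<open>F2\<close> at \<open>exp t\<close>, so it cancels. The limit t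
    cancels the t in ln (2 exp t), and only ln s / 4 at s = exp t survives.\<close>
  moreover have "F1 (exp t) - F1 1 + (t - F2 (exp t)) = t / 4"
    using ln_mult[of 2 "exp t"] by (simp add: F1_def F2_def)
  ultimately have total: "ennreal (F1 (exp t) - F1 1) + ennreal (t - F2 (exp t)) = ennreal (t / 4)"
    by (simp flip: ennreal_plus)
  have "(\<integral>\<^sup>+s. ennreal (?f s) * indicator {0..} s \<partial>lborel) =
      (\<integral>\<^sup>+s. ennreal (f1 s) * indicator {1..exp t} s + ennreal (f2 s) * indicator {exp t..} s \<partial>lborel)"
  proof (rule nn_integral_cong_AE)
    \<comment> \<open>The two pieces are closed, as the fundamental theorem of calculus wants, and
      overlap at \<open>exp t\<close>; the splitting is therefore claimed almost everywhere.\<close>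
    have "AE s in lborel. s \<noteq> exp t \<and> s \<noteq> 1"
      using AE_lborel_singleton[of "exp t"] AE_lborel_singleton[of "1::real"] by eventually_elim simp
    then show "AE s in lborel. ennreal (?f s) * indicator {0..} s =
        ennreal (f1 s) * indicator {1..exp t} s + ennreal (f2 s) * indicator {exp t..} s"
    proof eventually_elim
      case (elim s)
      consider "s < 0" | "0 \<le> s" "s < 1" | "1 < s" "s < exp t" | "exp t < s" using elim by linarith
      then show ?case
        by cases (use e in \<open>auto simp: f1_def f2_def geo_def geo_curv_def indicator_def simp del: one_le_exp_iff\<close>)
    qed
  qed
  also have "\<dots> = (\<integral>\<^sup>+s. ennreal (f1 s) * indicator {1..exp t} s \<partial>lborel) +
      (\<integral>\<^sup>+s. ennreal (f2 s) * indicator {exp t..} s \<partial>lborel)"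
    by (rule nn_integral_add) auto
  also have "(\<integral>\<^sup>+s. ennreal (f1 s) * indicator {1..exp t} s \<partial>lborel) = ennreal (F1 (exp t) - F1 1)"
    by (rule nn_integral_FTC_Icc) (use d1 e in auto)
  also have "(\<integral>\<^sup>+s. ennreal (f2 s) * indicator {exp t..} s \<partial>lborel) = ennreal (t - F2 (exp t))"
    by (rule nn_integral_FTC_atLeast) (use d2 lim in auto)
  also note total
  finally show ?thesis .
qed

subsection \<open>The K-energy\<close>

lemma energyE_geo:
  assumes t: "t \<ge> 0"
  shows "energyE (\<lambda>z. geo t ((cmod z)\<^sup>2)) = - t / 4"
proof -
  let ?g = "\<lambda>s. (ln (1 + s) - geo t s) * (geo_curv t s + 1 / (1 + s)\<^sup>2)"
  note curv_geo(2)[OF t, measurable]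
  have [measurable]: "geo t \<in> borel_measurable borel" "geo_curv t \<in> borel_measurable borel"
    unfolding geo_def[abs_def] geo_curv_def[abs_def] by measurable
  have [measurable]: "phiFS \<in> borel_measurable borel" "rho0 \<in> borel_measurable borel"
    unfolding phiFS_def[abs_def] rho0_def[abs_def] by measurable
  have nonneg: "0 \<le> ?g s" if "s \<ge> 0" for s
    using geo_FS_bounds(1)[OF t that] geo_curv_bounds(1)[OF t that] by (intro mult_nonneg_nonneg) auto
  have "has_bochner_integral lborel (\<lambda>z. 1 / pi * ?g ((cmod z)\<^sup>2)) (1 / pi * (pi * (t / 4)))"
  proof (rule has_bochner_integral_mult_right, rule has_bochner_integral_nn_integral)
    show "(\<integral>\<^sup>+z. ennreal (?g ((cmod z)\<^sup>2)) \<partial>lborel) = ennreal (pi * (t / 4))"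
      using t by (subst nn_integral_radial) (auto simp: geo_minus_FS_radial_integral[OF t] simp flip: ennreal_mult)
  qed (use nonneg t in auto)
  then have int: "(\<integral>z. 1 / pi * ?g ((cmod z)\<^sup>2) \<partial>lborel) = t / 4"
    by (auto dest: has_bochner_integral_integral_eq)
  have "energyE (\<lambda>z. geo t ((cmod z)\<^sup>2)) = (\<integral>z. - (1 / pi * ?g ((cmod z)\<^sup>2)) \<partial>lborel)"
    unfolding energyE_def
  proof (rule integral_cong_AE)
    show "AE z in lborel. (geo t ((cmod z)\<^sup>2) - phiFS z) * (curv (\<lambda>z. geo t ((cmod z)\<^sup>2)) z + rho0 z) =
        - (1 / pi * ?g ((cmod z)\<^sup>2))"
      using curv_geo(1)[OF t]
    proof eventually_elim
      case (elim z)
      have "(a - b) * (c / pi + 1 / (pi * d)) = - (1 / pi * ((b - a) * (c + 1 / d)))" for a b c d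
        by (simp add: algebra_simps diff_divide_distrib)
      then show ?case by (simp only: elim phiFS_def rho0_def)
    qed
  qed measurable
  also have "\<dots> = - t / 4"
    by (subst Bochner_Integration.integral_minus) (simp only: int minus_divide_left)
  finally show ?thesis .
qed

text \<open>Outside the annulus the metric is a constant plus a dilate of the Fubini--Study metric, so there
its potential is an affine function of the logarithm of its curvature density.\<close>

lemma entropy_integrand_geo:
  assumes t: "t \<ge> 0"
  shows "geo_curv t ((cmod z)\<^sup>2) / pi * ln (geo_curv t ((cmod z)\<^sup>2) / pi / rho0 z) =
    - 2 * ((geo t ((cmod z)\<^sup>2) - phiFS z) * (geo_curv t ((cmod z)\<^sup>2) / pi))"
proof -
  define s where "s = (cmod z)\<^sup>2"
  have s: "s \<ge> 0" by (simp add: s_def)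
  then have pos: "1 + s > 0" "exp t + s > 0" by (auto intro: add_pos_nonneg)
  have ratio: "c / pi / rho0 z = c * (1 + s)\<^sup>2" for c
    using pos by (simp add: rho0_def s_def[symmetric])
  \<comment> \<open>On the disc the ratio is 1 and the potentials agree, on the annulus both sides
    contain the factor 0. Only the outer region needs a computation.\<close>
  consider "s \<le> 1" | "1 < s" "s \<le> exp t" | "1 < s" "exp t < s" by linarith
  then have "geo_curv t s / pi * ln (geo_curv t s * (1 + s)\<^sup>2) =
      - 2 * ((geo t s - ln (1 + s)) * (geo_curv t s / pi))"
  proof cases
    case 3
    have "ln (exp t / (exp t + s)\<^sup>2 * (1 + s)\<^sup>2) = t - 2 * ln (exp t + s) + 2 * ln (1 + s)"
      using pos by (simp add: ln_mult ln_div ln_realpow)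
    also have "\<dots> = - 2 * (geo t s - ln (1 + s))"
      using 3 by (simp add: geo_def)
    finally have "ln (geo_curv t s * (1 + s)\<^sup>2) = - 2 * (geo t s - ln (1 + s))"
      using 3 by (simp add: geo_curv_def)
    then show ?thesis by (simp only: mult_ac)
  qed (use pos in \<open>auto simp: geo_def geo_curv_def\<close>)
  then show ?thesis
    by (simp only: ratio phiFS_def flip: s_def)
qed

text \<open>Let A and B be the integrals of the potential difference against the curvature and
  against \<open>rho0\<close>. The three terms are A + B, -2 B and -2 A, so the K-energy is minus
  the energy.\<close>

lemma Kenergy_geo:
  assumes t: "t \<ge> 0"
  shows "Kenergy (\<lambda>z. geo t ((cmod z)\<^sup>2)) = t / 4"
proof -
  let ?c = "curv (\<lambda>z. geo t ((cmod z)\<^sup>2))"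
  let ?D = "\<lambda>z. geo t ((cmod z)\<^sup>2) - phiFS z"
  note curv_geo(2)[OF t, measurable]
  have [measurable]: "geo t \<in> borel_measurable borel"
    unfolding geo_def[abs_def] by measurable
  have [measurable]: "phiFS \<in> borel_measurable borel" "rho0 \<in> borel_measurable borel"
    unfolding phiFS_def[abs_def] rho0_def[abs_def] by measurable
  have int_rho0: "integrable lborel rho0"
    using has_bochner_integral_rho0 by (rule integrable.intros)
  have D: "\<bar>?D z\<bar> \<le> t / 2" for z
    using geo_FS_bounds[OF t, of "(cmod z)\<^sup>2"] t by (simp add: phiFS_def)
  have rho0_nonneg: "0 \<le> rho0 z" for z by (simp add: rho0_def)
  have int1: "integrable lborel (\<lambda>z. ?D z * rho0 z)"
  proof (rule Bochner_Integration.integrable_bound[where f = "\<lambda>z. t / 2 * rho0 z"])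
    show "AE z in lborel. norm (?D z * rho0 z) \<le> norm (t / 2 * rho0 z)"
      using mult_right_mono[OF D rho0_nonneg] t rho0_nonneg by (intro AE_I2) (simp add: abs_mult)
  qed (use int_rho0 in auto)
  have int2: "integrable lborel (\<lambda>z. ?D z * ?c z)"
  proof (rule Bochner_Integration.integrable_bound[where f = "\<lambda>z. t / 2 * (exp t * rho0 z)"])
    show "AE z in lborel. norm (?D z * ?c z) \<le> norm (t / 2 * (exp t * rho0 z))"
      using curv_geo(1)[OF t]
    proof eventually_elim
      case (elim z)
      have "\<bar>?c z\<bar> \<le> exp t * rho0 z"
        using divide_right_mono[OF geo_curv_bounds(2)[OF t, of "(cmod z)\<^sup>2"], of pi]
          geo_curv_bounds(1)[OF t, of "(cmod z)\<^sup>2"]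
        by (simp add: elim rho0_def mult.commute)
      then have "\<bar>?D z\<bar> * \<bar>?c z\<bar> \<le> t / 2 * (exp t * rho0 z)"
        using D[of z] t by (intro mult_mono) auto
      then show ?case using t rho0_nonneg[of z] by (simp add: abs_mult)
    qed
  qed (use int_rho0 in auto)
  have E: "energyE (\<lambda>z. geo t ((cmod z)\<^sup>2)) = (\<integral>z. ?D z * ?c z \<partial>lborel) + (\<integral>z. ?D z * rho0 z \<partial>lborel)"
    unfolding energyE_def using int1 int2 by (simp add: distrib_left)
  have R: "energyRic (\<lambda>z. geo t ((cmod z)\<^sup>2)) = 2 * (\<integral>z. ?D z * rho0 z \<partial>lborel)"
    unfolding energyRic_def ric0_eq
    by (subst Bochner_Integration.integral_mult_right_zero[symmetric]) (simp add: mult_ac)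
  have "entropy (\<lambda>z. geo t ((cmod z)\<^sup>2)) = (\<integral>z. - 2 * (?D z * ?c z) \<partial>lborel)"
    unfolding entropy_def
  proof (rule integral_cong_AE)
    show "AE z in lborel. ?c z * ln (?c z / rho0 z) = - 2 * (?D z * ?c z)"
      using curv_geo(1)[OF t]
      by eventually_elim (simp only: entropy_integrand_geo[OF t])
  qed measurable
  also have "\<dots> = - 2 * (\<integral>z. ?D z * ?c z \<partial>lborel)"
    by (rule Bochner_Integration.integral_mult_right_zero)
  finally have "Kenergy (\<lambda>z. geo t ((cmod z)\<^sup>2)) = - energyE (\<lambda>z. geo t ((cmod z)\<^sup>2))"
    unfolding Kenergy_def Rbar_eq by (simp add: E R)
  then show ?thesis using energyE_geo[OF t] by simp
qed

subsection \<open>The Legendre transform\<close>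

lemma geo_exp:
  assumes "t \<ge> 0"
  shows "geo t (exp x) = (if x \<le> 0 then ln (1 + exp x) else if x \<le> t then ln 2 + x / 2
    else ln (1 + exp (x - t)) + t / 2)"
proof -
  have "exp t + exp x = exp t * (1 + exp (x - t))"
    by (simp add: distrib_left flip: exp_add)
  then have "ln (exp t + exp x) = t + ln (1 + exp (x - t))"
    using ln_mult[of "exp t" "1 + exp (x - t)"] add_pos_pos[of 1 "exp (x - t)"] by simp
  then show ?thesis by (simp add: geo_def)
qed

text \<open>The right side is the profile whose Legendre transform is u_0 + t (y - 1/2). With
  \<open>geo_FS_bounds(1)\<close>, which corresponds to u_0 itself, it bounds the transform of
  \<open>geo\<close> from below by the maximum of the two.\<close>

lemma geo_exp_le_shift:
  assumes t: "t \<ge> 0"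
  shows "geo t (exp x) \<le> ln (1 + exp (x - t)) + t / 2"
proof -
  consider "x \<le> 0" | "0 < x" "x \<le> t" | "0 < x" "t < x" by linarith
  then show ?thesis
  proof cases
    case 1
    define q where "q = exp (t / 2)"
    have q: "q \<ge> 1" "exp t = q\<^sup>2" using t by (auto simp: q_def power2_eq_square simp flip: exp_add)
    have "exp x \<le> q" using 1 t by (simp add: q_def)
    \<comment> \<open>Expanded, this is q (1 + exp x) <= q^2 + exp x, the counterpart of the
      factorisation in \<open>geo_FS_bounds\<close>.\<close>
    then have "0 \<le> (q - 1) * (q - exp x)" using q by (intro mult_nonneg_nonneg) auto
    then have "q * (1 + exp x) \<le> q * (q * (1 + exp (x - t)))"
      by (simp add: exp_diff q(2) algebra_simps power2_eq_square)
    then have "1 + exp x \<le> q * (1 + exp (x - t))" using q by simp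
    then have "ln (1 + exp x) \<le> ln (q * (1 + exp (x - t)))"
      using q by (subst ln_le_cancel_iff) (auto intro!: mult_pos_pos add_pos_pos)
    also have "\<dots> = t / 2 + ln (1 + exp (x - t))" 
      using ln_mult[of q "1 + exp (x - t)"] add_pos_pos[of 1 "exp (x - t)"] by (simp add: q_def)
    finally show ?thesis using 1 by (simp add: geo_exp[OF t])
  next
    case 2
    then show ?thesis
      using ln_two_sqrt_le[of "exp (x - t)"] by (simp add: geo_exp[OF t] field_simps)
  next
    case 3
    then show ?thesis by (simp add: geo_exp[OF t])
  qed
qed

lemma profile_geo: "profile (\<lambda>z. geo t ((cmod z)\<^sup>2)) x = geo t (exp x)"
  by (simp add: profile_def power2_eq_square flip: exp_add)

lemma legendre_geo:
  assumes t: "t \<ge> 0" and y: "y \<in> {0..1}"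
  shows "legendre (profile (\<lambda>z. geo t ((cmod z)\<^sup>2))) y =
    (SUP x. x * y - ln (1 + exp x)) + t * max 0 (y - 1 / 2)"
proof -
  let ?f = "\<lambda>x. x * y - ln (1 + exp x)"
  have "?f x \<le> 0" for x
  proof -
    have "x * y \<le> max 0 x"
      using y by (cases "x \<ge> 0") (auto simp: mult_left_le mult_nonpos_nonneg)
    also have "max 0 x \<le> ln (1 + exp x)"
      using ln_le_cancel_iff[of "exp x" "1 + exp x"] ln_ge_zero[of "1 + exp x"] by (simp add: add_pos_pos)
    finally show ?thesis by simp
  qed
  \<comment> \<open>A supremum of reals says something only for sets bounded above, so boundedness
    is settled before each use of \<open>cSUP_upper\<close>.\<close>
  then have bdd: "bdd_above (range ?f)" by (auto intro!: bdd_aboveI[of _ 0])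
  have upper: "x * y - geo t (exp x) \<le> (SUP x. ?f x) + t * max 0 (y - 1 / 2)" for x
  proof -
    \<comment> \<open>The competitor collapses the flat piece: \<open>x\<close> is kept on the left,
      sent to 0 between 0 and t, and to x - t on the right.\<close>
    have "\<exists>x'. x * y - geo t (exp x) \<le> ?f x' + t * max 0 (y - 1 / 2)"
    proof -
      consider "x \<le> 0" | "0 < x" "x \<le> t" | "0 < x" "t < x" by linarith
      then show ?thesis
      proof cases
        case 1
        then show ?thesis using t by (intro exI[of _ x]) (simp add: geo_exp[OF t])
      next
        case 2
        have "x * (y - 1 / 2) \<le> x * max 0 (y - 1 / 2)" using 2 by (intro mult_left_mono) auto
        also have "\<dots> \<le> t * max 0 (y - 1 / 2)" using 2 by (intro mult_right_mono) auto
        finally show ?thesis using 2 by (intro exI[of _ 0]) (simp add: geo_exp[OF t] algebra_simps)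
      next
        case 3
        have "t * (y - 1 / 2) \<le> t * max 0 (y - 1 / 2)" using t by (intro mult_left_mono) auto
        then show ?thesis using 3 by (intro exI[of _ "x - t"]) (simp add: geo_exp[OF t] algebra_simps)
      qed
    qed
    then obtain x' where "x * y - geo t (exp x) \<le> ?f x' + t * max 0 (y - 1 / 2)" by blast
    also have "?f x' \<le> (SUP x. ?f x)" by (rule cSUP_upper[OF UNIV_I bdd])
    finally show ?thesis by simp
  qed
  have bdd': "bdd_above (range (\<lambda>x. x * y - geo t (exp x)))"
    using upper by (auto intro!: bdd_aboveI)
  have lower: "?f x \<le> (SUP x. x * y - geo t (exp x)) - t * max 0 (y - 1 / 2)" for x
  proof (cases "y \<le> 1 / 2")
    case True
    have "?f x \<le> x * y - geo t (exp x)" using geo_FS_bounds(1)[OF t, of "exp x"] by simp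
    also have "\<dots> \<le> (SUP x. x * y - geo t (exp x))" by (rule cSUP_upper[OF UNIV_I bdd'])
    finally show ?thesis using True by (simp add: max_absorb1)
  next
    case False
    have "?f x + t * (y - 1 / 2) \<le> (x + t) * y - geo t (exp (x + t))"
      using geo_exp_le_shift[OF t, of "x + t"] by (simp add: algebra_simps)
    also have "\<dots> \<le> (SUP x. x * y - geo t (exp x))"
      by (rule cSUP_upper[OF UNIV_I bdd'])
    finally show ?thesis using False by (simp add: max_def)
  qed
  have "(SUP x. x * y - geo t (exp x)) \<le> (SUP x. ?f x) + t * max 0 (y - 1 / 2)"
    by (rule cSUP_least) (use upper in auto)
  moreover have "(SUP x. ?f x) \<le> (SUP x. x * y - geo t (exp x)) - t * max 0 (y - 1 / 2)"
    by (rule cSUP_least) (use lower in auto)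
  ultimately show ?thesis
    unfolding legendre_def profile_geo by simp
qed

lemma S1_geodesic_geo: "S1_geodesic (\<lambda>t z. geo t ((cmod z)\<^sup>2))"
  unfolding S1_geodesic_def
proof (intro conjI ballI)
  fix t y :: real assume t: "t \<in> {0..1}" and y: "y \<in> {0..1}"
  show "legendre (profile (\<lambda>z. geo t ((cmod z)\<^sup>2))) y =
      (1 - t) * legendre (profile (\<lambda>z. geo 0 ((cmod z)\<^sup>2))) y + t * legendre (profile (\<lambda>z. geo 1 ((cmod z)\<^sup>2))) y"
    using t y by (simp add: legendre_geo algebra_simps)
qed (auto simp: H11_geo S1_invariant_def norm_mult)

subsection \<open>Comparison with automorphisms\<close>

text \<open>Stronger than excluding a one-parameter subgroup: no single invertible matrix carries
  the initial metric to the final one.\<close>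

lemma geo_1_not_pullback:
  fixes g :: "complex^2^2"
  assumes g: "invertible g"
    and eq: "\<And>z. (g *v vector [1, z]) $ 1 \<noteq> 0 \<Longrightarrow>
      geo 1 ((cmod z)\<^sup>2) = pullback g (\<lambda>z. geo 0 ((cmod z)\<^sup>2)) z"
  shows False
proof -
  define a b c d where "a = g $ 1 $ 1" and "b = g $ 1 $ 2" and "c = g $ 2 $ 1" and "d = g $ 2 $ 2"
  have w: "(g *v vector [1, z]) $ 1 = a + b * z" "(g *v vector [1, z]) $ 2 = c + d * z" for z
    by (auto simp: a_def b_def c_def d_def matrix_vector_mult_def sum_2)
  have "det g \<noteq> 0" using g by (simp add: invertible_det_nz)
  then have ab: "a \<noteq> 0 \<or> b \<noteq> 0" by (auto simp: det_2 a_def b_def)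
  let ?F = "\<lambda>z. (cmod (a + b * z))\<^sup>2 + (cmod (c + d * z))\<^sup>2"
  have geo0: "geo 0 s = ln (1 + s)" if "s \<ge> 0" for s
    using that by (auto simp: geo_def)
  have off: "exp (geo 1 ((cmod z)\<^sup>2)) = ?F z" if z: "a + b * z \<noteq> 0" for z
  proof -
    have "geo 1 ((cmod z)\<^sup>2) = ln (1 + (cmod ((c + d * z) / (a + b * z)))\<^sup>2) + ln ((cmod (a + b * z))\<^sup>2)"
      using eq[of z] z by (simp add: w pullback_def geo0)
    also have "\<dots> = ln ((1 + (cmod ((c + d * z) / (a + b * z)))\<^sup>2) * (cmod (a + b * z))\<^sup>2)"
      using z by (intro ln_mult_pos[symmetric]) (auto simp: add_pos_nonneg)
    also have "(1 + (cmod ((c + d * z) / (a + b * z)))\<^sup>2) * (cmod (a + b * z))\<^sup>2 = ?F z"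
      using z by (simp add: norm_divide power_divide distrib_right)
    finally show ?thesis
      using z by (simp add: add_pos_nonneg)
  qed
  \<comment> \<open>The equation is given off the zero of the first component; both sides are
    continuous and the complement of a point is dense, so it holds on the whole plane.\<close>
  have "closed {z. exp (geo 1 ((cmod z)\<^sup>2)) = ?F z}"
    by (intro closed_Collect_eq continuous_intros geo_continuous) simp
  moreover have "- {- a / b} \<subseteq> {z. exp (geo 1 ((cmod z)\<^sup>2)) = ?F z}"
  proof
    fix z assume "z \<in> - {- a / b}"
    \<comment> \<open>For b = 0 the excluded point \<open>- a / b\<close> is 0 by the convention on
      division, and then a is nonzero, so the first component never vanishes.\<close>
    then have "a + b * z \<noteq> 0" using ab
      by (cases "b = 0") (auto simp: field_simps add_eq_0_iff)
    then show "z \<in> {z. exp (geo 1 ((cmod z)\<^sup>2)) = ?F z}" using off by simp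
  qed
  ultimately have "closure (- {- a / b}) \<subseteq> {z. exp (geo 1 ((cmod z)\<^sup>2)) = ?F z}"
    by (rule closure_minimal[rotated])
  then have all: "exp (geo 1 ((cmod z)\<^sup>2)) = ?F z" for z
    by (auto simp: closure_complement)
  define \<alpha> \<beta> \<gamma> where "\<alpha> = (cmod a)\<^sup>2 + (cmod c)\<^sup>2" and "\<beta> = 2 * (a \<bullet> b + c \<bullet> d)"
    and "\<gamma> = (cmod b)\<^sup>2 + (cmod d)\<^sup>2"
  have quad: "exp (geo 1 (r\<^sup>2)) = \<alpha> + \<beta> * r + \<gamma> * r\<^sup>2" for r :: real
  proof -
    have "exp (geo 1 (r\<^sup>2)) = ?F (of_real r)" using all[of "of_real r"] by simp
    also have "\<dots> = \<alpha> + \<beta> * r + \<gamma> * r\<^sup>2"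
      unfolding \<alpha>_def \<beta>_def \<gamma>_def cmod_power2 inner_complex_def
      by (simp add: power2_eq_square algebra_simps)
    finally show ?thesis .
  qed
  \<comment> \<open>The values at 0, 1/2 and 1 force the polynomial 1 + r^2. At r = 5/4, whose
    square 25/16 lies between 1 and exp 1, it would give 41/16, while the flat piece gives 2 r =
    40/16.\<close>
  have "\<alpha> = 1" using quad[of 0] by (simp add: geo_def)
  moreover have "\<alpha> + \<beta> + \<gamma> = 2" using quad[of 1] by (simp add: geo_def)
  moreover have "\<alpha> + \<beta> / 2 + \<gamma> / 4 = 5 / 4"
    using quad[of "1 / 2"] by (simp add: geo_def power2_eq_square)
  moreover have "\<alpha> + \<beta> * (5 / 4) + \<gamma> * (25 / 16) = 5 / 2"
  proof -
    have "(25 / 16 :: real) \<le> exp 1" using exp_ge_add_one_self[of 1] by simp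
    then have "geo 1 (25 / 16) = ln 2 + ln ((5 / 4)\<^sup>2) / 2"
      by (simp add: geo_def power2_eq_square)
    also have "\<dots> = ln 2 + ln (5 / 4)" by (simp only: ln_realpow)
    also have "\<dots> = ln (5 / 2)" using ln_mult_pos[of 2 "5 / 4 :: real"] by simp
    finally show ?thesis using quad[of "5 / 4"] by (simp add: power2_eq_square)
  qed
  ultimately show False by linarith
qed

theorem theorem1p1:
  shows "\<exists>Phi :: real \<Rightarrow> complex \<Rightarrow> real.
    S1_geodesic Phi \<and>
    (\<exists>a b. \<forall>t\<in>{0..1}. Kenergy (Phi t) = a + b * t) \<and>
    \<not> (\<exists>g. one_param_subgroup g \<and>
          (\<forall>t\<in>{0..1}. \<forall>z. (g t *v vector [1, z]) $ 1 \<noteq> 0 \<longrightarrow>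
              Phi t z = pullback (g t) (Phi 0) z))"
proof (intro exI[of _ "\<lambda>t z. geo t ((cmod z)\<^sup>2)"] conjI notI)
  show "S1_geodesic (\<lambda>t z. geo t ((cmod z)\<^sup>2))" by (rule S1_geodesic_geo)
  show "\<exists>a b. \<forall>t\<in>{0..1}. Kenergy (\<lambda>z. geo t ((cmod z)\<^sup>2)) = a + b * t"
    by (rule exI[of _ 0], rule exI[of _ "1 / 4"]) (simp add: Kenergy_geo)
  assume "\<exists>g. one_param_subgroup g \<and> (\<forall>t\<in>{0..1}. \<forall>z. (g t *v vector [1, z]) $ 1 \<noteq> 0 \<longrightarrow>
      geo t ((cmod z)\<^sup>2) = pullback (g t) (\<lambda>z. geo 0 ((cmod z)\<^sup>2)) z)"
  then obtain g where g: "one_param_subgroup g"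
    and eq: "\<And>t z. t \<in> {0..1} \<Longrightarrow> (g t *v vector [1, z]) $ 1 \<noteq> 0 \<Longrightarrow>
      geo t ((cmod z)\<^sup>2) = pullback (g t) (\<lambda>z. geo 0 ((cmod z)\<^sup>2)) z"
    by blast
  have "g 1 ** g (- 1) = mat 1" "g (- 1) ** g 1 = mat 1"
    using g unfolding one_param_subgroup_def by (metis add.right_inverse, metis add.left_inverse)
  then have "invertible (g 1)" unfolding invertible_def by blast
  then show False using geo_1_not_pullback[of "g 1"] eq[of 1] by simp
qed

end
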